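(* Let $\mathsf G$ be a simply-connected, unimodular Lie group with positive semi-definite Killing form. Then any algebraic generalized Ricci soliton $(g,H)$ on $\mathsf G$ has harmonic torsion, i.e. $d_g^*H=0$ (with $H$ closed).
   Context: Let $(\mathfrak g,\mu)$ be the Lie algebra of $\mathsf G$, $g$ a left-invariant Riemannian metric and $H$ a left-invariant closed $3$-form on $\mathsf G$, identified with tensors on $\mathfrak g$. $H^2(X,Y)=g(\iota_XH,\iota_YH)$ with the tensor inner product ($H^2(X,X)=\sum_{i,j}H(X,e_i,e_j)^2$ in an orthonormal basis), and $d_g^*$ is the codifferential. On $\mathfrak G=\mathfrak g\oplus\mathfrak g^*$ let $\mu_H$ be the $H$-twisted Dorfman bracket (a Lie bracket) $$\mu_H(X+\xi,Y+\eta)=\mu(X,Y)-\eta\circ\mathrm{ad}_\mu(X)+\xi\circ\mathrm{ad}_\mu(Y)+\iota_Y\iota_XH,\qquad \mathrm{ad}_\mu(X)=\mu(X,\cdot).$$ In block form with respect to $\mathfrak g\oplus\mathfrak g^*$, the generalized Ricci curvature is $$\mathcal Rc_{\mu_H}=\begin{pmatrix} R&\tfrac12g^{-1}(d_g^*H)g^{-1}\\-\tfrac12d_g^*H&-R^*\end{pmatrix},\qquad R=g^{-1}\big(\mathrm{Ric}_g-\tfrac14H^2\big),$$ and put $A_{\mu_H}=\tfrac12\begin{pmatrix}0&g^{-1}(d_g^*H)g^{-1}\\ d_g^*H&0\end{pmatrix}$ (2-forms and metrics are viewed as maps $\mathfrak g\to\mathfrak g^*$). For $E\in\mathrm{End}(\mathfrak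 G)$, $(\Theta(E)\mu_H)(x,y)=E\mu_H(x,y)-\mu_H(Ex,y)-\mu_H(x,Ey)$. The pair $(g,H)$ is an algebraic generalized Ricci soliton if there is $\lambda\in\mathbb R$ with $\Theta(\mathcal Rc_{\mu_H}-A_{\mu_H})\mu_H=\lambda\,\mu_H$. *)

theory Defs
  imports "HOL-Analysis.Analysis"
begin

text \<open>
  A simply connected Lie group is determined by its Lie algebra, and its left-invariant tensor
  fields are the tensors on that Lie algebra. Everything is therefore stated for a Lie bracket
  \<open>\<mu>\<close> on a finite-dimensional real vector space \<open>'a\<close>. The inner product of the
  class \<^class>\<open>euclidean_space\<close> serves only as a coordinate device (through \<open>Basis\<close>);
  the Riemannian metric is a separate, arbitrary positive definite form \<open>g\<close>.
\<close>

type_synonym 'a dual = "'a \<Rightarrow>\<^sub>L real"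

definition lin_trace :: "('a::euclidean_space \<Rightarrow> 'a) \<Rightarrow> real" where
  "lin_trace f = (\<Sum>b\<in>Basis. f b \<bullet> b)"

definition riemannian_metric :: "('a::euclidean_space \<Rightarrow> 'a \<Rightarrow> real) \<Rightarrow> bool" where
  "riemannian_metric g \<longleftrightarrow>
     bilinear g \<and> (\<forall>X Y. g X Y = g Y X) \<and> (\<forall>X. X \<noteq> 0 \<longrightarrow> g X X > 0)"

definition form_map :: "('a::euclidean_space \<Rightarrow> 'a \<Rightarrow> real) \<Rightarrow> 'a \<Rightarrow> 'a dual" where
  "form_map \<omega> X = Blinfun (\<omega> X)"

definition sharp :: "('a::euclidean_space \<Rightarrow> 'a \<Rightarrow> real) \<Rightarrow> 'a dual \<Rightarrow> 'a" where
  "sharp g = inv (form_map g)"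

text \<open>The contraction of a bilinear form with \<open>g\<close>, that is \<open>\<Sum>\<^sub>i \<beta>(e\<^sub>i, e\<^sub>i)\<close> in a
  \<open>g\<close>-orthonormal basis; see \<open>metric_trace_orthonormal\<close> below.\<close>

definition metric_trace ::
  "('a::euclidean_space \<Rightarrow> 'a \<Rightarrow> real) \<Rightarrow> ('a \<Rightarrow> 'a \<Rightarrow> real) \<Rightarrow> real" where
  "metric_trace g \<beta> = lin_trace (\<lambda>X. sharp g (form_map \<beta> X))"

definition form_inner ::
  "('a::euclidean_space \<Rightarrow> 'a \<Rightarrow> real) \<Rightarrow> ('a \<Rightarrow> 'a \<Rightarrow> real) \<Rightarrow> ('a \<Rightarrow> 'a \<Rightarrow> real) \<Rightarrow> real" where
  "form_inner g \<alpha> \<beta> = metric_trace g (\<lambda>U V. metric_trace g (\<lambda>S T. \<alpha> U S * \<beta> V T))"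

definition lie_bracket :: "('a::euclidean_space \<Rightarrow> 'a \<Rightarrow> 'a) \<Rightarrow> bool" where
  "lie_bracket \<mu> \<longleftrightarrow> bilinear \<mu> \<and> (\<forall>X. \<mu> X X = 0) \<and>
     (\<forall>X Y Z. \<mu> X (\<mu> Y Z) + \<mu> Y (\<mu> Z X) + \<mu> Z (\<mu> X Y) = 0)"

text \<open>For a connected Lie group, unimodularity is equivalent to \<open>tr (ad X) = 0\<close> for all \<open>X\<close>.\<close>

definition unimodular :: "('a::euclidean_space \<Rightarrow> 'a \<Rightarrow> 'a) \<Rightarrow> bool" where
  "unimodular \<mu> \<longleftrightarrow> (\<forall>X. lin_trace (\<mu> X) = 0)"

definition killing_form :: "('a::euclidean_space \<Rightarrow> 'a \<Rightarrow> 'a) \<Rightarrow> 'a \<Rightarrow> 'a \<Rightarrow> real" where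
  "killing_form \<mu> X Y = lin_trace (\<mu> X \<circ> \<mu> Y)"

definition three_form :: "('a::euclidean_space \<Rightarrow> 'a \<Rightarrow> 'a \<Rightarrow> real) \<Rightarrow> bool" where
  "three_form H \<longleftrightarrow>
     (\<forall>X Y. linear (\<lambda>Z. H X Y Z)) \<and> (\<forall>X Z. linear (\<lambda>Y. H X Y Z)) \<and> (\<forall>Y Z. linear (\<lambda>X. H X Y Z)) \<and>
     (\<forall>X Y. H X X Y = 0) \<and> (\<forall>X Y. H X Y Y = 0) \<and> (\<forall>X Y. H X Y X = 0)"

text \<open>The de Rham differential of a left-invariant form (Chevalley-Eilenberg formula).\<close>

definition ext_deriv3 ::
  "('a::euclidean_space \<Rightarrow> 'a \<Rightarrow> 'a) \<Rightarrow> ('a \<Rightarrow> 'a \<Rightarrow> 'a \<Rightarrow> real) \<Rightarrow> 'a \<Rightarrow> 'a \<Rightarrow> 'a \<Rightarrow> 'a \<Rightarrow> real" where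
  "ext_deriv3 \<mu> H X Y Z W =
     - H (\<mu> X Y) Z W + H (\<mu> X Z) Y W - H (\<mu> X W) Y Z
     - H (\<mu> Y Z) X W + H (\<mu> Y W) X Z - H (\<mu> Z W) X Y"

definition closed3 ::
  "('a::euclidean_space \<Rightarrow> 'a \<Rightarrow> 'a) \<Rightarrow> ('a \<Rightarrow> 'a \<Rightarrow> 'a \<Rightarrow> real) \<Rightarrow> bool" where
  "closed3 \<mu> H \<longleftrightarrow> (\<forall>X Y Z W. ext_deriv3 \<mu> H X Y Z W = 0)"

text \<open>The Koszul formula on left-invariant fields, where the derivative terms vanish:
  \<open>2 g(\<nabla>\<^sub>X Y, Z) = g([X,Y], Z) - g([Y,Z], X) + g([Z,X], Y)\<close>.\<close>

definition levi_civita ::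
  "('a::euclidean_space \<Rightarrow> 'a \<Rightarrow> 'a) \<Rightarrow> ('a \<Rightarrow> 'a \<Rightarrow> real) \<Rightarrow> 'a \<Rightarrow> 'a \<Rightarrow> 'a" where
  "levi_civita \<mu> g X Y =
     sharp g (Blinfun (\<lambda>Z. (g (\<mu> X Y) Z - g (\<mu> Y Z) X + g (\<mu> Z X) Y) / 2))"

definition riemann_curvature ::
  "('a::euclidean_space \<Rightarrow> 'a \<Rightarrow> 'a) \<Rightarrow> ('a \<Rightarrow> 'a \<Rightarrow> real) \<Rightarrow> 'a \<Rightarrow> 'a \<Rightarrow> 'a \<Rightarrow> 'a" where
  "riemann_curvature \<mu> g X Y Z =
     levi_civita \<mu> g X (levi_civita \<mu> g Y Z) - levi_civita \<mu> g Y (levi_civita \<mu> g X Z)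
     - levi_civita \<mu> g (\<mu> X Y) Z"

definition ricci ::
  "('a::euclidean_space \<Rightarrow> 'a \<Rightarrow> 'a) \<Rightarrow> ('a \<Rightarrow> 'a \<Rightarrow> real) \<Rightarrow> 'a \<Rightarrow> 'a \<Rightarrow> real" where
  "ricci \<mu> g X Y = lin_trace (\<lambda>Z. riemann_curvature \<mu> g Z X Y)"

definition cov_deriv3 ::
  "('a::euclidean_space \<Rightarrow> 'a \<Rightarrow> 'a) \<Rightarrow> ('a \<Rightarrow> 'a \<Rightarrow> real) \<Rightarrow> 'a \<Rightarrow>
     ('a \<Rightarrow> 'a \<Rightarrow> 'a \<Rightarrow> real) \<Rightarrow> 'a \<Rightarrow> 'a \<Rightarrow> 'a \<Rightarrow> real" where
  "cov_deriv3 \<mu> g U H X Y Z =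
     - H (levi_civita \<mu> g U X) Y Z - H X (levi_civita \<mu> g U Y) Z - H X Y (levi_civita \<mu> g U Z)"

text \<open>\<open>(d\<^sub>g\<^sup>* H)(X, Y) = - \<Sum>\<^sub>i (\<nabla>\<^bsub>e\<^sub>i\<^esub> H)(e\<^sub>i, X, Y)\<close>.\<close>

definition codiff ::
  "('a::euclidean_space \<Rightarrow> 'a \<Rightarrow> 'a) \<Rightarrow> ('a \<Rightarrow> 'a \<Rightarrow> real) \<Rightarrow>
     ('a \<Rightarrow> 'a \<Rightarrow> 'a \<Rightarrow> real) \<Rightarrow> 'a \<Rightarrow> 'a \<Rightarrow> real" where
  "codiff \<mu> g H X Y = - metric_trace g (\<lambda>U V. cov_deriv3 \<mu> g U H V X Y)"

definition H_square ::
  "('a::euclidean_space \<Rightarrow> 'a \<Rightarrow> real) \<Rightarrow> ('a \<Rightarrow> 'a \<Rightarrow> 'a \<Rightarrow> real) \<Rightarrow> 'a \<Rightarrow> 'a \<Rightarrow> real" where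
  "H_square g H X Y = form_inner g (H X) (H Y)"

definition dorfman ::
  "('a::euclidean_space \<Rightarrow> 'a \<Rightarrow> 'a) \<Rightarrow> ('a \<Rightarrow> 'a \<Rightarrow> 'a \<Rightarrow> real) \<Rightarrow>
     'a \<times> 'a dual \<Rightarrow> 'a \<times> 'a dual \<Rightarrow> 'a \<times> 'a dual" where
  "dorfman \<mu> H = (\<lambda>(X, \<xi>) (Y, \<eta>).
     (\<mu> X Y, Blinfun (\<lambda>Z. - \<eta> (\<mu> X Z) + \<xi> (\<mu> Y Z) + H X Y Z)))"

definition block_op ::
  "('a::euclidean_space \<Rightarrow> 'a) \<Rightarrow> ('a dual \<Rightarrow> 'a) \<Rightarrow> ('a \<Rightarrow> 'a dual) \<Rightarrow> ('a dual \<Rightarrow> 'a dual) \<Rightarrow>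
     'a \<times> 'a dual \<Rightarrow> 'a \<times> 'a dual" where
  "block_op a b c d = (\<lambda>(X, \<xi>). (a X + b \<xi>, c X + d \<xi>))"

definition dual_map :: "('a::euclidean_space \<Rightarrow> 'a) \<Rightarrow> 'a dual \<Rightarrow> 'a dual" where
  "dual_map f \<xi> = Blinfun (\<lambda>X. \<xi> (f X))"

definition ricci_H_endo ::
  "('a::euclidean_space \<Rightarrow> 'a \<Rightarrow> 'a) \<Rightarrow> ('a \<Rightarrow> 'a \<Rightarrow> real) \<Rightarrow>
     ('a \<Rightarrow> 'a \<Rightarrow> 'a \<Rightarrow> real) \<Rightarrow> 'a \<Rightarrow> 'a" where
  "ricci_H_endo \<mu> g H X = sharp g (form_map (\<lambda>U V. ricci \<mu> g U V - H_square g H U V / 4) X)"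

definition gen_ricci ::
  "('a::euclidean_space \<Rightarrow> 'a \<Rightarrow> 'a) \<Rightarrow> ('a \<Rightarrow> 'a \<Rightarrow> real) \<Rightarrow>
     ('a \<Rightarrow> 'a \<Rightarrow> 'a \<Rightarrow> real) \<Rightarrow> 'a \<times> 'a dual \<Rightarrow> 'a \<times> 'a dual" where
  "gen_ricci \<mu> g H = block_op
     (ricci_H_endo \<mu> g H)
     (\<lambda>\<xi>. (1/2) *\<^sub>R sharp g (form_map (codiff \<mu> g H) (sharp g \<xi>)))
     (\<lambda>X. - ((1/2) *\<^sub>R form_map (codiff \<mu> g H) X))
     (\<lambda>\<xi>. - dual_map (ricci_H_endo \<mu> g H) \<xi>)"

definition gen_skew ::
  "('a::euclidean_space \<Rightarrow> 'a \<Rightarrow> 'a) \<Rightarrow> ('a \<Rightarrow> 'a \<Rightarrow> real) \<Rightarrow>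
     ('a \<Rightarrow> 'a \<Rightarrow> 'a \<Rightarrow> real) \<Rightarrow> 'a \<times> 'a dual \<Rightarrow> 'a \<times> 'a dual" where
  "gen_skew \<mu> g H x = (1/2) *\<^sub>R block_op
     (\<lambda>X. 0)
     (\<lambda>\<xi>. sharp g (form_map (codiff \<mu> g H) (sharp g \<xi>)))
     (form_map (codiff \<mu> g H))
     (\<lambda>\<xi>. 0) x"

definition Theta :: "('v \<Rightarrow> 'v) \<Rightarrow> ('v \<Rightarrow> 'v \<Rightarrow> 'v) \<Rightarrow> 'v \<Rightarrow> 'v \<Rightarrow> 'v::real_vector" where
  "Theta E m x y = E (m x y) - m (E x) y - m x (E y)"

definition algebraic_gen_ricci_soliton ::
  "('a::euclidean_space \<Rightarrow> 'a \<Rightarrow> 'a) \<Rightarrow> ('a \<Rightarrow> 'a \<Rightarrow> real) \<Rightarrow>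
     ('a \<Rightarrow> 'a \<Rightarrow> 'a \<Rightarrow> real) \<Rightarrow> bool" where
  "algebraic_gen_ricci_soliton \<mu> g H \<longleftrightarrow>
     (\<exists>c::real. \<forall>x y.
        Theta (\<lambda>z. gen_ricci \<mu> g H z - gen_skew \<mu> g H z) (dorfman \<mu> H) x y
          = c *\<^sub>R dorfman \<mu> H x y)"

lemma Blinfun_apply: "linear f \<Longrightarrow> blinfun_apply (Blinfun f) = f"
  for f :: "'a::euclidean_space \<Rightarrow> real"
  by (simp add: bounded_linear_Blinfun_apply linear_conv_bounded_linear)

lemma form_map_apply: "bilinear \<omega> \<Longrightarrow> form_map \<omega> X Y = \<omega> X Y"
  for \<omega> :: "'a::euclidean_space \<Rightarrow> 'a \<Rightarrow> real"
  by (simp add: form_map_def bilinear_def Blinfun_apply)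

lemma bij_form_map:
  fixes g :: "'a::euclidean_space \<Rightarrow> 'a \<Rightarrow> real"
  assumes "riemannian_metric g"
  shows "bij (form_map g)"
proof -
  have bl: "bilinear g" using assms by (simp add: riemannian_metric_def)
  have zero: "X = 0" if "\<And>Y. g X Y = 0" for X
    using assms that unfolding riemannian_metric_def by (metis less_irrefl)
  define T where "T X = (\<Sum>b\<in>Basis. g X b *\<^sub>R b)" for X
  have "linear T"
    unfolding T_def
    by (auto intro!: linearI simp: bilinear_ladd[OF bl] bilinear_lmul[OF bl] scaleR_add_left
        sum.distrib scaleR_sum_right)
  have Tb: "T X \<bullet> b = g X b" if "b \<in> Basis" for X b
    using that by (simp add: T_def inner_sum_left inner_Basis if_distrib cong: if_cong)
  have ext: "\<xi> = \<zeta>" if "\<And>b. b \<in> Basis \<Longrightarrow> \<xi> b = \<zeta> b" for \<xi> \<zeta> :: "'a dual"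
    by (rule blinfun_euclidean_eqI) (use that in auto)
  have "X = 0" if "T X = 0" for X
  proof (rule zero)
    have "form_map g X = 0"
    proof (rule ext)
      fix b :: 'a assume "b \<in> Basis"
      then show "form_map g X b = blinfun_apply 0 b"
        using Tb[of b X] that by (simp add: form_map_apply[OF bl])
    qed
    then show "g X Y = 0" for Y by (metis form_map_apply[OF bl] zero_blinfun.rep_eq)
  qed
  then have injT: "inj T" using \<open>linear T\<close> linear_injective_0 by blast
  then have surjT: "surj T" using \<open>linear T\<close> linear_injective_imp_surjective by blast
  have "inj (form_map g)"
  proof (rule injI)
    fix X Y assume "form_map g X = form_map g Y"
    then have "T X = T Y" unfolding T_def by (metis form_map_apply[OF bl])
    then show "X = Y" using injT by (simp add: inj_eq)
  qed
  moreover have "\<exists>X. \<xi> = form_map g X" for \<xi>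
  proof -
    obtain X where X: "(\<Sum>b\<in>Basis. \<xi> b *\<^sub>R b) = T X" using surjT by blast
    have "\<xi> = form_map g X"
    proof (rule ext)
      fix b :: 'a assume b: "b \<in> Basis"
      have "\<xi> b = (\<Sum>c\<in>Basis. \<xi> c *\<^sub>R c) \<bullet> b"
        using b by (simp add: inner_sum_left inner_Basis if_distrib cong: if_cong)
      also have "\<dots> = g X b" using X Tb b by simp
      finally show "\<xi> b = form_map g X b" by (simp add: form_map_apply[OF bl])
    qed
    then show ?thesis ..
  qed
  ultimately show ?thesis by (auto simp: bij_def)
qed

lemma metric_sharp: "riemannian_metric g \<Longrightarrow> g (sharp g \<xi>) Y = \<xi> Y"
  using bij_form_map[of g] form_map_apply[of g "sharp g \<xi>" Y]
  by (simp add: sharp_def riemannian_metric_def bij_is_surj surj_f_inv_f)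

lemma metric_eqI:
  assumes "riemannian_metric g" "\<And>Z. g X Z = g Y Z"
  shows "X = Y"
proof -
  have "form_map g X = form_map g Y" unfolding form_map_def using assms(2) by presburger
  then show ?thesis using bij_form_map[OF assms(1)] by (simp add: bij_is_inj inj_eq)
qed

lemma metric_trace_orthonormal:
  fixes g :: "'a::euclidean_space \<Rightarrow> 'a \<Rightarrow> real"
  assumes g: "riemannian_metric g" and \<beta>: "bilinear \<beta>"
    and B: "finite B" "span B = UNIV" "\<And>u v. u \<in> B \<Longrightarrow> v \<in> B \<Longrightarrow> g u v = (if u = v then 1 else 0)"
  shows "metric_trace g \<beta> = (\<Sum>e\<in>B. \<beta> e e)"
proof -
  have bl: "bilinear g" using g by (simp add: riemannian_metric_def)
  have sh: "sharp g (form_map \<beta> X) = (\<Sum>e\<in>B. \<beta> X e *\<^sub>R e)" for X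
  proof (rule metric_eqI[OF g])
    have l1: "linear (\<beta> X)" using \<beta> by (simp add: bilinear_def)
    have l2: "linear (g (\<Sum>e\<in>B. \<beta> X e *\<^sub>R e))" using bl by (simp add: bilinear_def)
    have "\<beta> X v = g (\<Sum>e\<in>B. \<beta> X e *\<^sub>R e) v" if "v \<in> B" for v
    proof -
      have "g (\<Sum>e\<in>B. \<beta> X e *\<^sub>R e) v = (\<Sum>e\<in>B. \<beta> X e * g e v)"
        using linear_sum[of "\<lambda>x. g x v" "\<lambda>e. \<beta> X e *\<^sub>R e" B] bl
        by (simp add: bilinear_def bilinear_lmul[OF bl])
      also have "\<dots> = (\<Sum>e\<in>B. if e = v then \<beta> X e else 0)"
        using that by (intro sum.cong) (auto simp: B(3))
      also have "\<dots> = \<beta> X v" using that B(1) by simp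
      finally show ?thesis by simp
    qed
    then have "\<beta> X Z = g (\<Sum>e\<in>B. \<beta> X e *\<^sub>R e) Z" for Z
      using linear_eq_on[OF l1 l2, of Z B] B(2) by auto
    then show "g (sharp g (form_map \<beta> X)) Z = g (\<Sum>e\<in>B. \<beta> X e *\<^sub>R e) Z" for Z
      unfolding metric_sharp[OF g] form_map_apply[OF \<beta>] by metis
  qed
  have "(\<Sum>b\<in>Basis. \<beta> b e * (e \<bullet> b)) = \<beta> e e" for e
  proof -
    have le: "linear (\<lambda>x. \<beta> x e)" using \<beta> by (simp add: bilinear_def)
    have "\<beta> (\<Sum>b\<in>Basis. (e \<bullet> b) *\<^sub>R b) e = (\<Sum>b\<in>Basis. (e \<bullet> b) * \<beta> b e)"
      using linear_sum[OF le, of "\<lambda>b. (e \<bullet> b) *\<^sub>R b" Basis] by (simp add: bilinear_lmul[OF \<beta>])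
    then show ?thesis by (simp add: euclidean_representation mult.commute)
  qed
  then show ?thesis
    unfolding metric_trace_def lin_trace_def sh
    by (simp add: inner_sum_left) (subst sum.swap, simp)
qed

lemma form_inner_orthonormal:
  fixes g :: "'a::euclidean_space \<Rightarrow> 'a \<Rightarrow> real"
  assumes g: "riemannian_metric g" and \<alpha>: "bilinear \<alpha>" and \<beta>: "bilinear \<beta>"
    and B: "finite B" "span B = UNIV" "\<And>u v. u \<in> B \<Longrightarrow> v \<in> B \<Longrightarrow> g u v = (if u = v then 1 else 0)"
  shows "form_inner g \<alpha> \<beta> = (\<Sum>u\<in>B. \<Sum>v\<in>B. \<alpha> u v * \<beta> u v)"
proof -
  note bl = bilinear_ladd[OF \<alpha>] bilinear_radd[OF \<alpha>] bilinear_lmul[OF \<alpha>] bilinear_rmul[OF \<alpha>]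
    bilinear_ladd[OF \<beta>] bilinear_radd[OF \<beta>] bilinear_lmul[OF \<beta>] bilinear_rmul[OF \<beta>]
  have 1: "bilinear (\<lambda>S T. \<alpha> U S * \<beta> V T)" for U V
    unfolding bilinear_def by (auto intro!: linearI simp: bl algebra_simps)
  have 2: "bilinear (\<lambda>U V. \<Sum>v\<in>B. \<alpha> U v * \<beta> V v)"
    unfolding bilinear_def
    by (auto intro!: linearI simp: bl algebra_simps sum.distrib sum_distrib_left)
  have "metric_trace g (\<lambda>S T. \<alpha> U S * \<beta> V T) = (\<Sum>v\<in>B. \<alpha> U v * \<beta> V v)" for U V
    using g 1 B by (rule metric_trace_orthonormal)
  moreover have "metric_trace g (\<lambda>U V. \<Sum>v\<in>B. \<alpha> U v * \<beta> V v) = (\<Sum>u\<in>B. \<Sum>v\<in>B. \<alpha> u v * \<beta> u v)"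
    using g 2 B by (rule metric_trace_orthonormal)
  ultimately show ?thesis by (simp add: form_inner_def)
qed

lemma levi_civita_koszul:
  assumes mu: "lie_bracket \<mu>" and g: "riemannian_metric g"
  shows "g (levi_civita \<mu> g X Y) Z = (g (\<mu> X Y) Z - g (\<mu> Y Z) X + g (\<mu> Z X) Y) / 2"
proof -
  have bg: "bilinear g" using g by (simp add: riemannian_metric_def)
  have bm: "bilinear \<mu>" using mu by (simp add: lie_bracket_def)
  have "linear (\<lambda>Z. (g (\<mu> X Y) Z - g (\<mu> Y Z) X + g (\<mu> Z X) Y) / 2)"
    by (rule linearI)
      (simp_all add: bilinear_ladd[OF bg] bilinear_radd[OF bg] bilinear_lmul[OF bg]
        bilinear_rmul[OF bg] bilinear_ladd[OF bm] bilinear_radd[OF bm] bilinear_lmul[OF bm]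
        bilinear_rmul[OF bm] field_simps)
  then show ?thesis by (simp add: levi_civita_def metric_sharp[OF g] Blinfun_apply)
qed

lemma lie_bracket_skew:
  assumes "lie_bracket \<mu>"
  shows "\<mu> Y X = - \<mu> X Y"
proof -
  have b: "bilinear \<mu>" and z: "\<And>X. \<mu> X X = 0" using assms by (auto simp: lie_bracket_def)
  have "\<mu> (X + Y) (X + Y) = \<mu> X X + \<mu> Y X + (\<mu> X Y + \<mu> Y Y)"
    by (simp only: bilinear_ladd[OF b] bilinear_radd[OF b])
  then have "\<mu> Y X + \<mu> X Y = 0" by (simp add: z)
  then show ?thesis by (rule eq_neg_iff_add_eq_0[THEN iffD2])
qed

lemma levi_civita_torsion_free:
  assumes mu: "lie_bracket \<mu>" and g: "riemannian_metric g"
  shows "levi_civita \<mu> g X Y - levi_civita \<mu> g Y X = \<mu> X Y"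
proof (rule metric_eqI[OF g])
  have bg: "bilinear g" using g by (simp add: riemannian_metric_def)
  show "g (levi_civita \<mu> g X Y - levi_civita \<mu> g Y X) Z = g (\<mu> X Y) Z" for Z
    using lie_bracket_skew[OF mu, of X Y] lie_bracket_skew[OF mu, of X Z]
      lie_bracket_skew[OF mu, of Y Z]
    by (simp add: bilinear_lsub[OF bg] levi_civita_koszul[OF mu g] bilinear_lneg[OF bg] field_simps)
qed

lemma levi_civita_metric:
  assumes mu: "lie_bracket \<mu>" and g: "riemannian_metric g"
  shows "g (levi_civita \<mu> g X Y) Z + g Y (levi_civita \<mu> g X Z) = 0"
proof -
  have bg: "bilinear g" and sym: "\<And>X Y. g X Y = g Y X"
    using g by (auto simp: riemannian_metric_def)
  have "g (levi_civita \<mu> g X Y) Z + g (levi_civita \<mu> g X Z) Y = 0"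
    using lie_bracket_skew[OF mu, of X Y] lie_bracket_skew[OF mu, of X Z]
      lie_bracket_skew[OF mu, of Y Z]
    by (simp add: levi_civita_koszul[OF mu g] bilinear_lneg[OF bg] field_simps)
  then show ?thesis by (simp add: sym)
qed

end

theory Submission
  imports Defs
begin

text \<open>
  Write \<open>\<beta>\<close> for the codifferential of \<open>H\<close> and \<open>R\<close> for the endomorphism
  \<open>g\<^sup>-\<^sup>1 (Ric - H\<^sup>2/4)\<close>. Subtracting the skew part cancels the upper right block of
  the generalized Ricci curvature, so the soliton condition is about the block triangular operator
  \<open>(X, \<xi>) \<mapsto> (R X, - \<beta> X - R\<^sup>* \<xi>)\<close>. On pairs of vectors it says two things
  (\<open>soliton_equations\<close>): \<open>R\<close> is a derivation of \<open>\<mu>\<close> up to a multiple \<open>c\<close> of the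
  bracket, and \<open>d\<beta> = R\<cdot>H + c H\<close>, where \<open>R\<cdot>\<close> inserts \<open>R\<close> into each
  argument in turn. The aim is to show \<open>d\<beta> = 0\<close>: since \<open>\<mu>\<close> is unimodular, the codifferential
  is adjoint to \<open>d\<close> (\<open>codiff_adjoint\<close>), and then \<open>|\<beta>|\<^sup>2 = \<langle>H, d\<beta>\<rangle> = 0\<close>.

  To this end \<open>\<langle>\<beta>, R\<cdot>\<beta>\<rangle>\<close> is computed twice. Because \<open>R\<close> is a derivation up to
  \<open>c\<close>, \<open>d(R\<cdot>\<beta>) = R\<cdot>d\<beta> + c d\<beta>\<close>; adjointness, the symmetry of \<open>R\<close> and
  the second soliton equation turn the pairing into \<open>|d\<beta>|\<^sup>2\<close> (\<open>sum_act2_soliton\<close>).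
  On the other hand, if \<open>b\<close> is the skew endomorphism with \<open>g(b X, Y) = \<beta>(X, Y)\<close>, the pairing is
  \<open>\<Sum> g(R b e, b e)\<close> over an orthonormal frame (\<open>sum_act2_endo\<close>), and for unimodular
  \<open>\<mu>\<close>
  \<open>
    Ric(X, X) = - 1/2 \<Sum> |\<mu>(X, e)|\<^sup>2 + 1/4 \<Sum> g(\<mu>(e, f), X)\<^sup>2 - 1/2 K(X, X)
  \<close>
  with \<open>K\<close> the Killing form (\<open>ricci_frame\<close>). With \<open>X = b e\<close> the first two sums can be completed to
  squares: up to positive factors they equal \<open>|d\<beta>|\<^sup>2\<close> minus a sum of squares
  (\<open>sum_ext_deriv2_square\<close>). The coefficient of \<open>|d\<beta>|\<^sup>2\<close> so produced is only half of the one
  coming from the first computation. Comparing the two leaves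
  \<open>|d\<beta>|\<^sup>2\<close>, a sum of squares, the \<open>H\<^sup>2\<close> term and \<open>\<Sum> K(b e, b e)\<close>, all nonnegative with
  positive coefficients, adding up to zero.
\<close>

section \<open>Orthonormal frames\<close>

text \<open>
  One Gram--Schmidt step per vector: subtract the projection onto the frame found so far and
  normalize, unless nothing is left.
\<close>

lemma exists_orthonormal_spanning:
  fixes g :: "'a::euclidean_space \<Rightarrow> 'a \<Rightarrow> real"
  assumes g: "riemannian_metric g" and "finite S"
  shows "\<exists>B. finite B \<and> span B = span S \<and>
    (\<forall>u\<in>B. \<forall>v\<in>B. g u v = (if u = v then 1 else 0))"
  using \<open>finite S\<close>
proof (induction S)
  case empty
  then show ?case by blast
next
  case (insert x S)
  have bl: "bilinear g" and sym: "\<And>X Y. g X Y = g Y X" and pos: "\<And>X. X \<noteq> 0 \<Longrightarrow> g X X > 0"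
    using g by (auto simp: riemannian_metric_def)
  from insert.IH obtain B where B: "finite B" "span B = span S"
    and orth: "\<And>u v. u \<in> B \<Longrightarrow> v \<in> B \<Longrightarrow> g u v = (if u = v then 1 else 0)" by blast
  define p where "p = (\<Sum>e\<in>B. g x e *\<^sub>R e)"
  define y where "y = x - p"
  have p: "p \<in> span B" unfolding p_def by (intro span_sum span_scale span_base)
  have xy: "x = y + p" by (simp add: y_def)
  have span_x: "span (insert x S) = span (insert x B)"
    unfolding span_insert B(2) ..
  have y_orth: "g y v = 0" if "v \<in> B" for v
  proof -
    have "g p v = (\<Sum>e\<in>B. g x e * g e v)"
      using linear_sum[of "\<lambda>x. g x v" "\<lambda>e. g x e *\<^sub>R e" B] bl
      by (simp add: p_def bilinear_def bilinear_lmul[OF bl])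
    also have "\<dots> = (\<Sum>e\<in>B. if e = v then g x e else 0)"
      using that by (intro sum.cong) (auto simp: orth)
    also have "\<dots> = g x v" using that B(1) by simp
    finally show ?thesis by (simp add: y_def bilinear_lsub[OF bl])
  qed
  show ?case
  proof (cases "y = 0")
    case True
    then have "x \<in> span B" using p xy by simp
    then have "span (insert x B) = span B" by (rule span_redundant)
    then show ?thesis using B(1) orth span_x by (intro exI[of _ B]) simp
  next
    case False
    define z where "z = (1 / sqrt (g y y)) *\<^sub>R y"
    have gy: "g y y > 0" using pos False by blast
    have yz: "y = sqrt (g y y) *\<^sub>R z" using gy by (simp add: z_def)
    have zz: "g z z = 1"
      using gy by (simp add: z_def bilinear_lmul[OF bl] bilinear_rmul[OF bl])
    have zB: "g z v = 0" "g v z = 0" if "v \<in> B" for v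
      using y_orth[OF that] sym[of v z] by (simp_all add: z_def bilinear_lmul[OF bl])
    have "x \<in> span (insert z B)"
    proof -
      have "p \<in> span (insert z B)" using p span_mono[OF subset_insertI] by blast
      moreover have "sqrt (g y y) *\<^sub>R z \<in> span (insert z B)"
        by (intro span_scale span_base) simp
      ultimately show ?thesis using xy yz span_add by metis
    qed
    moreover have "z \<in> span (insert x B)"
    proof -
      have "p \<in> span (insert x B)" using p span_mono[OF subset_insertI] by blast
      then show ?thesis unfolding z_def y_def
        by (intro span_scale span_diff) (auto intro: span_base)
    qed
    ultimately have "span (insert z B) = span (insert x B)"
      unfolding span_eq using span_superset[of "insert x B"] span_superset[of "insert z B"]
      by blast
    moreover have "g u v = (if u = v then 1 else 0)"
      if "u \<in> insert z B" "v \<in> insert z B" for u v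
    proof (cases "u = z \<or> v = z")
      case True
      have "z \<notin> B" using zB(1)[of z] zz by auto
      then show ?thesis using True that zz zB by auto
    next
      case False
      then show ?thesis using that orth by auto
    qed
    ultimately show ?thesis using B(1) span_x by (intro exI[of _ "insert z B"]) simp
  qed
qed

locale orthonormal_frame =
  fixes g :: "'a::euclidean_space \<Rightarrow> 'a \<Rightarrow> real" and B :: "'a set"
  assumes metric: "riemannian_metric g"
    and finite_frame: "finite B"
    and span_frame: "span B = UNIV"
    and orthonormal: "\<And>u v. u \<in> B \<Longrightarrow> v \<in> B \<Longrightarrow> g u v = (if u = v then 1 else 0)"
begin

lemma bilinear_metric: "bilinear g"
  using metric by (simp add: riemannian_metric_def)

lemma metric_sym: "g X Y = g Y X"
  using metric by (simp add: riemannian_metric_def)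

lemmas metric_lin = bilinear_ladd[OF bilinear_metric] bilinear_radd[OF bilinear_metric]
  bilinear_lmul[OF bilinear_metric] bilinear_rmul[OF bilinear_metric]
  bilinear_lneg[OF bilinear_metric] bilinear_rneg[OF bilinear_metric]
  bilinear_lsub[OF bilinear_metric] bilinear_rsub[OF bilinear_metric]

lemma metric_zero: "g 0 Y = 0" "g Y 0 = 0"
  using bilinear_lzero[OF bilinear_metric] bilinear_rzero[OF bilinear_metric] by auto

lemma frame_expansion: "X = (\<Sum>e\<in>B. g X e *\<^sub>R e)"
proof -
  have id: "linear (\<lambda>X::'a. X)" by (simp add: linear_iff)
  have L: "linear (\<lambda>X. \<Sum>e\<in>B. g X e *\<^sub>R e)"
    by (rule linearI) (simp_all add: metric_lin scaleR_add_left sum.distrib scaleR_sum_right)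
  have "v = (\<Sum>e\<in>B. g v e *\<^sub>R e)" if "v \<in> B" for v
  proof -
    have "(\<Sum>e\<in>B. g v e *\<^sub>R e) = (\<Sum>e\<in>B. if e = v then e else 0)"
      using that by (intro sum.cong) (auto simp: orthonormal)
    then show ?thesis using that finite_frame by simp
  qed
  then show ?thesis using linear_eq_on[OF id L, of X B] span_frame by auto
qed

lemma linear_frame:
  fixes h :: "'a \<Rightarrow> 'b::real_vector"
  assumes "linear h"
  shows "h X = (\<Sum>e\<in>B. g X e *\<^sub>R h e)"
  using arg_cong[OF frame_expansion[of X], of h]
  by (simp add: linear_sum[OF assms] linear_cmul[OF assms])

lemma parseval: "g X Y = (\<Sum>e\<in>B. g X e * g Y e)"
proof -
  have "linear (\<lambda>X. g X Y)" by (rule linearI) (simp_all add: metric_lin)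
  from linear_frame[OF this, of X] show ?thesis by (simp add: metric_sym)
qed

lemma trace_frame:
  assumes "linear f"
  shows "lin_trace f = (\<Sum>e\<in>B. g (f e) e)"
proof -
  have bl: "bilinear (\<lambda>X Y. g (f X) Y)"
    unfolding bilinear_def
    by (auto intro!: linearI simp: metric_lin linear_add[OF assms] linear_cmul[OF assms])
  have "sharp g (form_map (\<lambda>X Y. g (f X) Y) X) = f X" for X
    by (rule metric_eqI[OF metric]) (simp add: metric_sharp[OF metric] form_map_apply[OF bl])
  then have "lin_trace f = metric_trace g (\<lambda>X Y. g (f X) Y)"
    by (simp add: metric_trace_def)
  also have "\<dots> = (\<Sum>e\<in>B. g (f e) e)"
    by (rule metric_trace_orthonormal[OF metric bl finite_frame span_frame orthonormal])
  finally show ?thesis .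
qed

text \<open>
  The tensor \<open>\<Sum> e \<otimes> e\<close> does not depend on the frame, so an endomorphism moves from one of
  its slots to the other as its adjoint. Applied to symmetric and to skew endomorphisms, this replaces
  the manipulation of traces by the index bookkeeping of frame sums.
\<close>

lemma sum_adjoint:
  fixes F :: "'a \<Rightarrow> 'a \<Rightarrow> real"
  assumes F: "bilinear F" and adj: "\<And>X Y. g (S X) Y = g X (S' Y)"
  shows "(\<Sum>e\<in>B. F (S e) e) = (\<Sum>e\<in>B. F e (S' e))"
proof -
  have l: "linear (\<lambda>X. F X Y)" "linear (F Y)" for Y using F by (simp_all add: bilinear_def)
  have "(\<Sum>e\<in>B. F (S e) e) = (\<Sum>e\<in>B. \<Sum>k\<in>B. g (S e) k * F k e)"
    by (intro sum.cong refl) (simp only: linear_frame[OF l(1), symmetric] flip: real_scaleR_def)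
  also have "\<dots> = (\<Sum>k\<in>B. \<Sum>e\<in>B. g (S' k) e * F k e)"
    unfolding adj by (subst sum.swap) (simp add: metric_sym)
  also have "\<dots> = (\<Sum>k\<in>B. F k (S' k))"
    by (intro sum.cong refl) (simp only: linear_frame[OF l(2), symmetric] flip: real_scaleR_def)
  finally show ?thesis .
qed

lemma zero_if_zero_on_frame:
  assumes \<beta>: "bilinear \<beta>" and z: "\<And>x y. x \<in> B \<Longrightarrow> y \<in> B \<Longrightarrow> \<beta> x y = (0::real)"
  shows "\<beta> X Y = 0"
proof -
  have l: "linear (\<lambda>X. \<beta> X Y)" "linear (\<beta> Y)" for Y using \<beta> by (simp_all add: bilinear_def)
  have "\<beta> x Y = 0" if "x \<in> B" for x
    using linear_frame[OF l(2)[of x], of Y] z that by simp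
  then show ?thesis using linear_frame[OF l(1), of X Y] by simp
qed

end

lemma sum_rotate:
  fixes F :: "'a \<Rightarrow> 'a \<Rightarrow> 'a \<Rightarrow> 'b::comm_monoid_add"
  shows "(\<Sum>x\<in>B. \<Sum>y\<in>B. \<Sum>z\<in>B. F y z x) = (\<Sum>x\<in>B. \<Sum>y\<in>B. \<Sum>z\<in>B. F x y z)"
  by (subst sum.swap) (intro sum.cong refl sum.swap)

text \<open>
  Symmetric and skew matrices are orthogonal. Here \<open>- p - p\<^sup>T\<close> and \<open>k\<close> are the
  symmetric and skew part of one factor, as they appear in twice the covariant derivative.
\<close>

lemma sum_mult_sym_skew_split:
  fixes p q k l :: "'a \<Rightarrow> 'a \<Rightarrow> real"
  assumes k: "\<And>x y. k y x = - k x y" and l: "\<And>x y. l y x = - l x y"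
  shows "(\<Sum>x\<in>B. \<Sum>y\<in>B. (k x y - p x y - p y x) * (l x y - q x y - q y x)) =
    2 * (\<Sum>x\<in>B. \<Sum>y\<in>B. p x y * q x y) + 2 * (\<Sum>x\<in>B. \<Sum>y\<in>B. p x y * q y x)
    + (\<Sum>x\<in>B. \<Sum>y\<in>B. k x y * l x y)"
proof -
  have sw: "(\<Sum>x\<in>B. \<Sum>y\<in>B. f y x) = (\<Sum>x\<in>B. \<Sum>y\<in>B. f x y)" for f :: "'a \<Rightarrow> 'a \<Rightarrow> real"
    by (rule sum.swap)
  have "(\<Sum>x\<in>B. \<Sum>y\<in>B. p y x * q y x) = (\<Sum>x\<in>B. \<Sum>y\<in>B. p x y * q x y)"
    "(\<Sum>x\<in>B. \<Sum>y\<in>B. p y x * q x y) = (\<Sum>x\<in>B. \<Sum>y\<in>B. p x y * q y x)"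
    "(\<Sum>x\<in>B. \<Sum>y\<in>B. k x y * q y x) = - (\<Sum>x\<in>B. \<Sum>y\<in>B. k x y * q x y)"
    "(\<Sum>x\<in>B. \<Sum>y\<in>B. l x y * p y x) = - (\<Sum>x\<in>B. \<Sum>y\<in>B. l x y * p x y)"
    using sw[of "\<lambda>x y. p x y * q x y"] sw[of "\<lambda>x y. p x y * q y x"]
      sw[of "\<lambda>x y. k x y * q y x"] sw[of "\<lambda>x y. l x y * p y x"]
    unfolding sum_negf[symmetric] minus_mult_left k[symmetric] l[symmetric] by simp_all
  then show ?thesis
    by (simp add: algebra_simps sum.distrib sum_subtractf)
qed

section \<open>Ricci curvature and codifferential in a frame\<close>

locale metric_lie_algebra = orthonormal_frame g B
  for g :: "'a::euclidean_space \<Rightarrow> 'a \<Rightarrow> real" and B :: "'a set" +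
  fixes \<mu> :: "'a \<Rightarrow> 'a \<Rightarrow> 'a"
  assumes lie: "lie_bracket \<mu>"
begin

lemma bilinear_bracket: "bilinear \<mu>"
  using lie by (simp add: lie_bracket_def)

lemmas bracket_lin = bilinear_ladd[OF bilinear_bracket] bilinear_radd[OF bilinear_bracket]
  bilinear_lmul[OF bilinear_bracket] bilinear_rmul[OF bilinear_bracket]
  bilinear_lneg[OF bilinear_bracket] bilinear_rneg[OF bilinear_bracket]
  bilinear_lsub[OF bilinear_bracket] bilinear_rsub[OF bilinear_bracket]

lemmas bracket_skew = lie_bracket_skew[OF lie]
lemmas koszul = levi_civita_koszul[OF lie metric]

abbreviation nabla :: "'a \<Rightarrow> 'a \<Rightarrow> 'a" where "nabla \<equiv> levi_civita \<mu> g"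

lemma bilinear_nabla: "bilinear nabla"
  unfolding bilinear_def
  by (auto intro!: linearI metric_eqI[OF metric]
      simp: koszul metric_lin bracket_lin field_simps)

lemmas nabla_lin = bilinear_ladd[OF bilinear_nabla] bilinear_radd[OF bilinear_nabla]
  bilinear_lmul[OF bilinear_nabla] bilinear_rmul[OF bilinear_nabla]
  bilinear_lneg[OF bilinear_nabla] bilinear_rneg[OF bilinear_nabla]
  bilinear_lsub[OF bilinear_nabla] bilinear_rsub[OF bilinear_nabla]

lemma killing_frame:
  "killing_form \<mu> X Y = (\<Sum>x\<in>B. \<Sum>y\<in>B. g (\<mu> X x) y * g (\<mu> Y y) x)"
proof -
  have "linear (\<mu> X \<circ> \<mu> Y)"
    by (rule linearI) (simp_all add: bracket_lin)
  then have "killing_form \<mu> X Y = (\<Sum>x\<in>B. g (\<mu> X (\<mu> Y x)) x)"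
    by (simp add: killing_form_def trace_frame)
  also have "\<dots> = (\<Sum>x\<in>B. \<Sum>y\<in>B. g (\<mu> Y x) y * g (\<mu> X y) x)"
  proof (intro sum.cong refl)
    fix x
    have "linear (\<lambda>Z. g (\<mu> X Z) x)" by (rule linearI) (simp_all add: metric_lin bracket_lin)
    from linear_frame[OF this, of "\<mu> Y x"]
    show "g (\<mu> X (\<mu> Y x)) x = (\<Sum>y\<in>B. g (\<mu> Y x) y * g (\<mu> X y) x)" by simp
  qed
  also have "\<dots> = (\<Sum>x\<in>B. \<Sum>y\<in>B. g (\<mu> X x) y * g (\<mu> Y y) x)"
    by (subst sum.swap) (simp add: mult.commute)
  finally show ?thesis .
qed

text \<open>
  The vector \<open>\<Sum> \<nabla>\<^sub>e e\<close> is metrically dual to \<open>Z \<mapsto> tr (ad Z)\<close>. Its vanishing is what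
  removes the mean curvature terms from the Ricci curvature and from the codifferential.
\<close>

lemma unimodular_sum_nabla:
  assumes "unimodular \<mu>"
  shows "(\<Sum>e\<in>B. nabla e e) = 0"
proof (rule metric_eqI[OF metric])
  fix Z
  have lg: "linear (\<lambda>X. g X Z)" by (rule linearI) (simp_all add: metric_lin)
  have "g (nabla e e) Z = g (\<mu> Z e) e" for e
    using bracket_skew[of e Z] lie by (simp add: koszul metric_lin metric_zero lie_bracket_def)
  moreover have "lin_trace (\<mu> Z) = (\<Sum>e\<in>B. g (\<mu> Z e) e)"
    by (rule trace_frame) (rule linearI; simp add: bracket_lin)
  ultimately show "g (\<Sum>e\<in>B. nabla e e) Z = g 0 Z"
    using assms by (simp add: linear_sum[OF lg] unimodular_def linear_0[OF lg])
qed

text \<open>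
  Metric compatibility gives \<open>g(\<nabla>\<^sub>e \<nabla>\<^sub>X Y, e) = - g(\<nabla>\<^sub>X Y, \<nabla>\<^sub>e e)\<close>, which sums to zero.
  In the remaining terms torsion-freeness replaces \<open>\<nabla>\<^sub>X e\<close> by \<open>\<nabla>\<^sub>e X + \<mu>(X, e)\<close>; everything
  involving \<open>\<mu>(X, e)\<close> only uses the symmetric part \<open>- (ad Y + ad Y\<^sup>T)/2\<close> of
  \<open>U \<mapsto> \<nabla>\<^sub>U Y\<close>, and \<open>\<Sum> g(\<nabla>\<^sub>e Y, \<nabla>\<^sub>e X)\<close> splits into symmetric and skew parts.
\<close>

lemma ricci_frame:
  assumes uni: "unimodular \<mu>"
  shows "ricci \<mu> g X Y =
    - (\<Sum>x\<in>B. \<Sum>y\<in>B. g (\<mu> X x) y * g (\<mu> Y x) y) / 2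
    + (\<Sum>x\<in>B. \<Sum>y\<in>B. g (\<mu> x y) X * g (\<mu> x y) Y) / 4
    - killing_form \<mu> X Y / 2"
proof -
  have "linear (\<lambda>Z. riemann_curvature \<mu> g Z X Y)"
    unfolding riemann_curvature_def
    by (rule linearI) (simp_all add: nabla_lin bracket_lin algebra_simps)
  then have "ricci \<mu> g X Y = (\<Sum>e\<in>B. g (riemann_curvature \<mu> g e X Y) e)"
    by (simp add: ricci_def trace_frame)
  also have "\<dots> = (\<Sum>e\<in>B. - g (nabla X Y) (nabla e e) + g (nabla e Y) (nabla e X)
      - g (\<mu> Y e) (\<mu> X e) - g (\<mu> Y (\<mu> X e)) e)"
  proof (intro sum.cong refl)
    fix e
    have m: "g (nabla U V) W = - g V (nabla U W)" for U V W
      using levi_civita_metric[OF lie metric, of U V W] by simp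
    have t: "nabla X e = nabla e X + \<mu> X e"
      using levi_civita_torsion_free[OF lie metric, of X e] by (simp add: algebra_simps)
    \<comment> \<open>Symmetrizing \<open>U \<mapsto> \<nabla>\<^sub>U Y\<close> cancels the terms with \<open>\<mu> U V\<close> in the Koszul formula.\<close>
    have s: "g (nabla e Y) (\<mu> X e) + g (nabla (\<mu> X e) Y) e
        = - g (\<mu> Y e) (\<mu> X e) - g (\<mu> Y (\<mu> X e)) e"
      using bracket_skew[of e Y] bracket_skew[of "\<mu> X e" Y] bracket_skew[of e "\<mu> X e"]
      by (simp add: koszul metric_lin field_simps)
    have "g (riemann_curvature \<mu> g e X Y) e =
        g (nabla e (nabla X Y)) e - g (nabla X (nabla e Y)) e + g (nabla (\<mu> X e) Y) e"
      using bracket_skew[of X e]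
      by (simp add: riemann_curvature_def metric_lin nabla_lin)
    also have "\<dots> = - g (nabla X Y) (nabla e e) + g (nabla e Y) (nabla X e)
        + g (nabla (\<mu> X e) Y) e"
      by (simp add: m)
    finally show "g (riemann_curvature \<mu> g e X Y) e = - g (nabla X Y) (nabla e e)
        + g (nabla e Y) (nabla e X) - g (\<mu> Y e) (\<mu> X e) - g (\<mu> Y (\<mu> X e)) e"
      using s by (simp add: t metric_lin)
  qed
  also have "\<dots> = - (\<Sum>e\<in>B. g (nabla X Y) (nabla e e)) + (\<Sum>e\<in>B. g (nabla e Y) (nabla e X))
      - (\<Sum>e\<in>B. g (\<mu> Y e) (\<mu> X e)) - (\<Sum>e\<in>B. g (\<mu> Y (\<mu> X e)) e)"
    by (simp add: sum.distrib sum_subtractf sum_negf)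
  also have "(\<Sum>e\<in>B. g (nabla X Y) (nabla e e)) = 0"
  proof -
    have lg: "linear (g (nabla X Y))" by (rule linearI) (simp_all add: metric_lin)
    show ?thesis
      using linear_sum[OF lg, of "\<lambda>e. nabla e e" B] unimodular_sum_nabla[OF uni]
      by (simp add: linear_0[OF lg])
  qed
  also have "(\<Sum>e\<in>B. g (\<mu> Y e) (\<mu> X e)) = (\<Sum>x\<in>B. \<Sum>y\<in>B. g (\<mu> X x) y * g (\<mu> Y x) y)"
    by (intro sum.cong refl) (subst parseval, simp add: mult.commute)
  also have "(\<Sum>e\<in>B. g (\<mu> Y (\<mu> X e)) e) = killing_form \<mu> X Y"
  proof -
    have "g (\<mu> Y (\<mu> X x)) x = (\<Sum>y\<in>B. g (\<mu> X x) y * g (\<mu> Y y) x)" for x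
    proof -
      have "linear (\<lambda>Z. g (\<mu> Y Z) x)" by (rule linearI) (simp_all add: metric_lin bracket_lin)
      from linear_frame[OF this, of "\<mu> X x"] show ?thesis by simp
    qed
    then show ?thesis by (simp add: killing_frame)
  qed
  also have "(\<Sum>e\<in>B. g (nabla e Y) (nabla e X)) =
      (\<Sum>x\<in>B. \<Sum>y\<in>B. g (\<mu> X x) y * g (\<mu> Y x) y) / 2 + killing_form \<mu> X Y / 2
      + (\<Sum>x\<in>B. \<Sum>y\<in>B. g (\<mu> x y) X * g (\<mu> x y) Y) / 4"
  proof -
    have N: "g (nabla x Z) y = (g (\<mu> y x) Z - g (\<mu> Z x) y - g (\<mu> Z y) x) / 2" for x y Z
      using bracket_skew[of x Z] by (simp add: koszul metric_lin)
    have sk: "g (\<mu> x y) Z = - g (\<mu> y x) Z" for x y Z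
      unfolding bracket_skew[of x y] by (simp add: metric_lin)
    have "(\<Sum>e\<in>B. g (nabla e Y) (nabla e X)) =
        (\<Sum>x\<in>B. \<Sum>y\<in>B. (g (\<mu> y x) X - g (\<mu> X x) y - g (\<mu> X y) x) *
          (g (\<mu> y x) Y - g (\<mu> Y x) y - g (\<mu> Y y) x)) / 4"
      unfolding sum_divide_distrib
      by (intro sum.cong refl) (subst parseval, simp add: N mult.commute sum_divide_distrib)
    also have "(\<Sum>x\<in>B. \<Sum>y\<in>B. (g (\<mu> y x) X - g (\<mu> X x) y - g (\<mu> X y) x) *
          (g (\<mu> y x) Y - g (\<mu> Y x) y - g (\<mu> Y y) x)) =
      2 * (\<Sum>x\<in>B. \<Sum>y\<in>B. g (\<mu> X x) y * g (\<mu> Y x) y)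
      + 2 * (\<Sum>x\<in>B. \<Sum>y\<in>B. g (\<mu> X x) y * g (\<mu> Y y) x)
      + (\<Sum>x\<in>B. \<Sum>y\<in>B. g (\<mu> y x) X * g (\<mu> y x) Y)"
      by (rule sum_mult_sym_skew_split[of "\<lambda>x y. g (\<mu> y x) X" "\<lambda>x y. g (\<mu> y x) Y"]) (rule sk)+
    also have "(\<Sum>x\<in>B. \<Sum>y\<in>B. g (\<mu> y x) X * g (\<mu> y x) Y)
        = (\<Sum>x\<in>B. \<Sum>y\<in>B. g (\<mu> x y) X * g (\<mu> x y) Y)"
      by (rule sum.swap)
    finally show ?thesis by (simp add: killing_frame)
  qed
  finally show ?thesis by simp
qed

end

section \<open>Invariant forms on a metric Lie algebra\<close>

text \<open>
  The Chevalley--Eilenberg differential of a 2-form, with the terms in cyclic order; for a skew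
  \<open>\<gamma>\<close> this is the usual alternating formula.
\<close>

definition ext_deriv2 ::
  "('a \<Rightarrow> 'a \<Rightarrow> 'a) \<Rightarrow> ('a \<Rightarrow> 'a \<Rightarrow> real) \<Rightarrow> 'a \<Rightarrow> 'a \<Rightarrow> 'a \<Rightarrow> real" where
  "ext_deriv2 \<mu> \<gamma> X Y Z = - \<gamma> (\<mu> X Y) Z - \<gamma> (\<mu> Y Z) X - \<gamma> (\<mu> Z X) Y"

text \<open>
  The derivative of the pullback of a form along \<open>exp (t R)\<close>, that is, minus the
  usual action of an endomorphism on forms.
\<close>

definition act2 :: "('a \<Rightarrow> 'a) \<Rightarrow> ('a \<Rightarrow> 'a \<Rightarrow> real) \<Rightarrow> 'a \<Rightarrow> 'a \<Rightarrow> real" where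
  "act2 R \<gamma> X Y = \<gamma> (R X) Y + \<gamma> X (R Y)"

definition act3 :: "('a \<Rightarrow> 'a) \<Rightarrow> ('a \<Rightarrow> 'a \<Rightarrow> 'a \<Rightarrow> real) \<Rightarrow> 'a \<Rightarrow> 'a \<Rightarrow> 'a \<Rightarrow> real" where
  "act3 R \<omega> X Y Z = \<omega> (R X) Y Z + \<omega> X (R Y) Z + \<omega> X Y (R Z)"

lemma sum_cyclic:
  fixes F :: "'a \<Rightarrow> 'a \<Rightarrow> 'a \<Rightarrow> real"
  shows "(\<Sum>x\<in>B. \<Sum>y\<in>B. \<Sum>z\<in>B. F x y z + F y z x + F z x y) =
    3 * (\<Sum>x\<in>B. \<Sum>y\<in>B. \<Sum>z\<in>B. F x y z)"
  using sum_rotate[of F B] sum_rotate[of "\<lambda>x y z. F y z x" B] by (simp add: sum.distrib)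

lemma sum_swap_pairs:
  fixes F :: "'a \<Rightarrow> 'a \<Rightarrow> 'a \<Rightarrow> 'a \<Rightarrow> real"
  shows "(\<Sum>x\<in>B. \<Sum>y\<in>B. \<Sum>u\<in>B. \<Sum>v\<in>B. F x y u v) =
    (\<Sum>u\<in>B. \<Sum>v\<in>B. \<Sum>x\<in>B. \<Sum>y\<in>B. F x y u v)"
proof -
  have "(\<Sum>x\<in>B. \<Sum>y\<in>B. \<Sum>u\<in>B. \<Sum>v\<in>B. F x y u v) =
      (\<Sum>x\<in>B. \<Sum>u\<in>B. \<Sum>y\<in>B. \<Sum>v\<in>B. F x y u v)"
    by (intro sum.cong refl sum.swap)
  also have "\<dots> = (\<Sum>u\<in>B. \<Sum>x\<in>B. \<Sum>v\<in>B. \<Sum>y\<in>B. F x y u v)"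
    by (subst sum.swap) (intro sum.cong refl sum.swap)
  also have "\<dots> = (\<Sum>u\<in>B. \<Sum>v\<in>B. \<Sum>x\<in>B. \<Sum>y\<in>B. F x y u v)"
    by (intro sum.cong refl sum.swap)
  finally show ?thesis .
qed

lemma sum_mult_skew:
  fixes f k :: "'a \<Rightarrow> 'a \<Rightarrow> real"
  assumes k: "\<And>x y. k y x = - k x y"
  shows "(\<Sum>x\<in>B. \<Sum>y\<in>B. f x y * k x y) = - (\<Sum>x\<in>B. \<Sum>y\<in>B. f y x * k x y)"
proof -
  have "(\<Sum>x\<in>B. \<Sum>y\<in>B. f x y * k x y) = (\<Sum>x\<in>B. \<Sum>y\<in>B. f y x * k y x)"
    by (rule sum.swap)
  also have "\<dots> = (\<Sum>x\<in>B. \<Sum>y\<in>B. - (f y x * k x y))"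
    using k by (intro sum.cong refl) (metis mult_minus_right)
  finally show ?thesis by (simp add: sum_negf)
qed

lemma skew_of_alternating:
  fixes f :: "'a::real_vector \<Rightarrow> 'a \<Rightarrow> real"
  assumes "\<And>X. linear (f X)" "\<And>Y. linear (\<lambda>X. f X Y)" "\<And>X. f X X = 0"
  shows "f Y X = - f X Y"
proof -
  have "f (X + Y) (X + Y) = f X X + f Y X + (f X Y + f Y Y)"
    using linear_add[OF assms(1)] linear_add[OF assms(2)] by metis
  then show ?thesis using assms(3) by simp
qed

lemma three_form_linear:
  assumes "three_form H"
  shows "H (X + X') Y Z = H X Y Z + H X' Y Z" "H X (Y + Y') Z = H X Y Z + H X Y' Z"
    "H X Y (Z + Z') = H X Y Z + H X Y Z'" "H (a *\<^sub>R X) Y Z = a * H X Y Z"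
    "H X (a *\<^sub>R Y) Z = a * H X Y Z" "H X Y (a *\<^sub>R Z) = a * H X Y Z"
  using assms unfolding three_form_def linear_iff by auto

lemma three_form_skew:
  assumes "three_form H"
  shows "H Y X Z = - H X Y Z" "H X Z Y = - H X Y Z"
proof -
  show "H Y X Z = - H X Y Z"
    by (rule skew_of_alternating[of "\<lambda>X Y. H X Y Z"]) (use assms in \<open>simp_all add: three_form_def\<close>)
  show "H X Z Y = - H X Y Z"
    by (rule skew_of_alternating[of "H X"]) (use assms in \<open>simp_all add: three_form_def\<close>)
qed

lemma three_form_cyclic:
  assumes "three_form H"
  shows "H Y Z X = H X Y Z"
  using three_form_skew[OF assms, of X Y Z] three_form_skew[OF assms, of Y X Z] by simp

context metric_lie_algebra
begin

text \<open>
  The term with \<open>\<nabla>\<^sub>e e\<close> vanishes by unimodularity. In the others \<open>\<nabla>\<^sub>e X\<close> is contracted with two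
  skew slots of \<open>H\<close>, so only the skew part of \<open>U \<mapsto> \<nabla>\<^sub>U X\<close>, which is given by
  \<open>- g(\<mu>(u, v), X)/2\<close>, survives.
\<close>

lemma codiff_frame:
  assumes uni: "unimodular \<mu>" and H: "three_form H"
  shows "codiff \<mu> g H X Y =
    ((\<Sum>u\<in>B. \<Sum>v\<in>B. g (\<mu> u v) Y * H u v X) - (\<Sum>u\<in>B. \<Sum>v\<in>B. g (\<mu> u v) X * H u v Y)) / 2"
proof -
  note Hl = three_form_linear[OF H]
  have bl: "bilinear (\<lambda>U V. cov_deriv3 \<mu> g U H V X Y)"
    unfolding bilinear_def cov_deriv3_def
    by (auto intro!: linearI simp: nabla_lin Hl algebra_simps)
  have half: "(\<Sum>e\<in>B. H e (nabla e X) Y) = - (\<Sum>u\<in>B. \<Sum>v\<in>B. g (\<mu> u v) X * H u v Y) / 2" for X Y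
  proof -
    have l: "linear (\<lambda>Z. H e Z Y)" for e using H by (simp add: three_form_def)
    have "(\<Sum>e\<in>B. H e (nabla e X) Y) = (\<Sum>u\<in>B. \<Sum>v\<in>B. g (nabla u X) v * H u v Y)"
      by (intro sum.cong refl) (simp only: linear_frame[OF l, symmetric] flip: real_scaleR_def)
    moreover have "(\<Sum>u\<in>B. \<Sum>v\<in>B. g (nabla u X) v * H u v Y) =
        (\<Sum>u\<in>B. \<Sum>v\<in>B. - (g (nabla v X) u * H u v Y))"
      unfolding sum_negf by (rule sum_mult_skew) (rule three_form_skew(1)[OF H])
    moreover have "g (nabla u X) v - g (nabla v X) u = - g (\<mu> u v) X" for u v
      using bracket_skew[of u X] bracket_skew[of v X] bracket_skew[of u v]
      by (simp add: koszul metric_lin field_simps)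
    then have "(\<Sum>u\<in>B. \<Sum>v\<in>B. g (nabla u X) v * H u v Y)
        + (\<Sum>u\<in>B. \<Sum>v\<in>B. - (g (nabla v X) u * H u v Y)) =
        (\<Sum>u\<in>B. \<Sum>v\<in>B. - (g (\<mu> u v) X * H u v Y))"
      unfolding sum.distrib[symmetric]
      by (intro sum.cong refl) (metis (no_types, lifting) add_uminus_conv_diff left_diff_distrib
          mult_minus_left)
    ultimately show ?thesis by (simp add: sum_negf)
  qed
  have l1: "linear (\<lambda>Z. H Z X Y)" using H by (simp add: three_form_def)
  have "codiff \<mu> g H X Y = - (\<Sum>e\<in>B. cov_deriv3 \<mu> g e H e X Y)"
    unfolding codiff_def
    by (subst metric_trace_orthonormal[OF metric bl finite_frame span_frame orthonormal]) auto
  also have "\<dots> = (\<Sum>e\<in>B. H (nabla e e) X Y) + (\<Sum>e\<in>B. H e (nabla e X) Y)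
      + (\<Sum>e\<in>B. H e X (nabla e Y))"
    by (simp add: cov_deriv3_def sum.distrib sum_negf sum_subtractf)
  also have "(\<Sum>e\<in>B. H (nabla e e) X Y) = 0"
    using linear_sum[OF l1, of "\<lambda>e. nabla e e" B] unimodular_sum_nabla[OF uni]
    by (simp add: linear_0[OF l1])
  also have "(\<Sum>e\<in>B. H e X (nabla e Y)) = - (\<Sum>e\<in>B. H e (nabla e Y) X)"
    unfolding sum_negf[symmetric] by (intro sum.cong refl three_form_skew(2)[OF H])
  finally show ?thesis unfolding half by simp
qed

lemma bilinear_codiff:
  assumes "unimodular \<mu>" and H: "three_form H"
  shows "bilinear (codiff \<mu> g H)"
  unfolding bilinear_def codiff_frame[OF assms]
  by (auto intro!: linearI simp: metric_lin three_form_linear[OF H] algebra_simps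
      sum.distrib sum_distrib_left sum_subtractf diff_divide_distrib add_divide_distrib)

lemma codiff_skew:
  assumes "unimodular \<mu>" and "three_form H"
  shows "codiff \<mu> g H Y X = - codiff \<mu> g H X Y"
  by (simp add: codiff_frame[OF assms] field_simps)

text \<open>
  The factor 3 is the quotient of the normalizations \<open>1/3!\<close> and \<open>1/2!\<close> of the inner products of
  forms: full sums over the frame count each component of a 3-form six times, each component of
  a 2-form twice.
\<close>

lemma codiff_adjoint:
  assumes uni: "unimodular \<mu>" and H: "three_form H"
    and \<gamma>: "bilinear \<gamma>" and skew: "\<And>X Y. \<gamma> Y X = - \<gamma> X Y"
  shows "(\<Sum>x\<in>B. \<Sum>y\<in>B. \<Sum>z\<in>B. H x y z * ext_deriv2 \<mu> \<gamma> x y z) =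
    3 * (\<Sum>x\<in>B. \<Sum>y\<in>B. codiff \<mu> g H x y * \<gamma> x y)"
proof -
  define C where "C x y = (\<Sum>u\<in>B. \<Sum>v\<in>B. g (\<mu> u v) x * H u v y)" for x y
  have lg: "linear (\<lambda>X. \<gamma> X y)" for y using \<gamma> by (simp add: bilinear_def)
  have "(\<Sum>x\<in>B. \<Sum>y\<in>B. \<Sum>z\<in>B. H x y z * ext_deriv2 \<mu> \<gamma> x y z) =
      3 * (\<Sum>x\<in>B. \<Sum>y\<in>B. \<Sum>z\<in>B. - (H x y z * \<gamma> (\<mu> x y) z))"
    unfolding sum_cyclic[symmetric]
  proof (intro sum.cong refl)
    fix x y z
    have "H y z x = H x y z" "H z x y = H x y z"
      by (metis three_form_cyclic[OF H])+
    then show "H x y z * ext_deriv2 \<mu> \<gamma> x y z = - (H x y z * \<gamma> (\<mu> x y) z)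
        + - (H y z x * \<gamma> (\<mu> y z) x) + - (H z x y * \<gamma> (\<mu> z x) y)"
      by (simp add: ext_deriv2_def algebra_simps)
  qed
  moreover have "(\<Sum>x\<in>B. \<Sum>y\<in>B. codiff \<mu> g H x y * \<gamma> x y) = - (\<Sum>x\<in>B. \<Sum>y\<in>B. C x y * \<gamma> x y)"
  proof -
    have "(\<Sum>x\<in>B. \<Sum>y\<in>B. C y x * \<gamma> x y) = - (\<Sum>x\<in>B. \<Sum>y\<in>B. C x y * \<gamma> x y)"
      by (rule sum_mult_skew) (rule skew)
    then show ?thesis
      by (simp add: codiff_frame[OF uni H] C_def[symmetric] diff_divide_distrib left_diff_distrib
          sum_subtractf flip: sum_divide_distrib)
  qed
  moreover have "(\<Sum>x\<in>B. \<Sum>y\<in>B. C x y * \<gamma> x y) =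
      (\<Sum>x\<in>B. \<Sum>y\<in>B. \<Sum>z\<in>B. H x y z * \<gamma> (\<mu> x y) z)"
  proof -
    have "(\<Sum>x\<in>B. \<Sum>y\<in>B. C x y * \<gamma> x y) =
        (\<Sum>x\<in>B. \<Sum>y\<in>B. \<Sum>u\<in>B. \<Sum>v\<in>B. g (\<mu> u v) x * H u v y * \<gamma> x y)"
      by (simp add: C_def sum_distrib_right)
    also have "\<dots> = (\<Sum>u\<in>B. \<Sum>v\<in>B. \<Sum>y\<in>B. \<Sum>x\<in>B. g (\<mu> u v) x * H u v y * \<gamma> x y)"
      by (subst sum_swap_pairs) (intro sum.cong refl sum.swap)
    also have "\<dots> = (\<Sum>u\<in>B. \<Sum>v\<in>B. \<Sum>y\<in>B. H u v y * \<gamma> (\<mu> u v) y)"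
    proof (intro sum.cong refl)
      fix u v y
      show "(\<Sum>x\<in>B. g (\<mu> u v) x * H u v y * \<gamma> x y) = H u v y * \<gamma> (\<mu> u v) y"
        using linear_frame[OF lg[of y], of "\<mu> u v"]
        by (simp add: sum_distrib_left mult.assoc mult.left_commute)
    qed
    finally show ?thesis .
  qed
  ultimately show ?thesis by (simp add: sum_negf)
qed

lemma bilinear_ricci:
  assumes "unimodular \<mu>"
  shows "bilinear (ricci \<mu> g)" "ricci \<mu> g X Y = ricci \<mu> g Y X"
proof -
  show "bilinear (ricci \<mu> g)"
    unfolding bilinear_def ricci_frame[OF assms] killing_frame
    by (auto intro!: linearI simp: metric_lin bracket_lin algebra_simps sum.distrib
        sum_distrib_left diff_divide_distrib add_divide_distrib)
  have "killing_form \<mu> X Y = killing_form \<mu> Y X"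
    unfolding killing_frame by (subst sum.swap) (simp add: mult.commute)
  then show "ricci \<mu> g X Y = ricci \<mu> g Y X"
    by (simp add: ricci_frame[OF assms] mult.commute)
qed

lemma H_square_frame:
  assumes H: "three_form H"
  shows "H_square g H X Y = (\<Sum>u\<in>B. \<Sum>v\<in>B. H X u v * H Y u v)"
proof -
  have "bilinear (H X)" for X using H by (simp add: three_form_def bilinear_def)
  then show ?thesis
    unfolding H_square_def
    by (intro form_inner_orthonormal[OF metric _ _ finite_frame span_frame orthonormal]) auto
qed

lemma ricci_H_endo_metric:
  assumes uni: "unimodular \<mu>" and H: "three_form H"
  shows "g (ricci_H_endo \<mu> g H X) Y = ricci \<mu> g X Y - H_square g H X Y / 4"
proof -
  note r = bilinear_ricci(1)[OF uni]
  have "bilinear (\<lambda>U V. ricci \<mu> g U V - H_square g H U V / 4)"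
    unfolding bilinear_def H_square_frame[OF H]
    by (auto intro!: linearI simp: bilinear_ladd[OF r] bilinear_radd[OF r] bilinear_lmul[OF r]
        bilinear_rmul[OF r] three_form_linear[OF H] algebra_simps sum.distrib
        sum_distrib_left add_divide_distrib)
  then show ?thesis
    by (simp add: ricci_H_endo_def metric_sharp[OF metric] form_map_apply)
qed

lemma ricci_H_endo_sym:
  assumes uni: "unimodular \<mu>" and H: "three_form H"
  shows "g (ricci_H_endo \<mu> g H X) Y = g X (ricci_H_endo \<mu> g H Y)"
  by (simp add: metric_sym[of X] ricci_H_endo_metric[OF assms] H_square_frame[OF H] mult.commute
      bilinear_ricci(2)[OF uni, of X])

section \<open>The soliton equations\<close>

text \<open>
  The vector and the covector component of the soliton condition on pairs of vectors.
\<close>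

lemma soliton_equations:
  assumes uni: "unimodular \<mu>" and H: "three_form H"
    and sol: "algebraic_gen_ricci_soliton \<mu> g H"
  defines "R \<equiv> ricci_H_endo \<mu> g H" and "\<beta> \<equiv> codiff \<mu> g H"
  obtains c where "\<And>X Y. R (\<mu> X Y) = \<mu> (R X) Y + \<mu> X (R Y) + c *\<^sub>R \<mu> X Y"
    and "\<And>X Y Z. ext_deriv2 \<mu> \<beta> X Y Z = act3 R H X Y Z + c * H X Y Z"
proof -
  define E where "E z = gen_ricci \<mu> g H z - gen_skew \<mu> g H z" for z
  from sol obtain c where c: "\<And>x y. Theta E (dorfman \<mu> H) x y = c *\<^sub>R dorfman \<mu> H x y"
    unfolding algebraic_gen_ricci_soliton_def E_def by blast
  have bl: "bilinear \<beta>" unfolding \<beta>_def by (rule bilinear_codiff[OF uni H])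
  have skew: "\<beta> Y X = - \<beta> X Y" for X Y unfolding \<beta>_def by (rule codiff_skew[OF uni H])
  \<comment> \<open>The skew correction cancels the upper right block and doubles the lower left one.\<close>
  have E: "E (X, \<xi>) = (R X, - form_map \<beta> X - dual_map R \<xi>)" for X \<xi>
  proof -
    have half: "(1/2) *\<^sub>R v + (1/2) *\<^sub>R v = v" for v :: "'a dual"
      by (simp flip: scaleR_add_left)
    have "- ((1/2) *\<^sub>R v) - (1/2) *\<^sub>R v = - v" for v :: "'a dual"
      using arg_cong[OF half[of v], of uminus] by simp
    then show ?thesis
      by (simp add: E_def gen_ricci_def gen_skew_def block_op_def R_def \<beta>_def)
  qed
  have Rlin: "linear R"
    by (auto intro!: linearI metric_eqI[OF metric]
        simp: R_def ricci_H_endo_sym[OF uni H] metric_lin)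
  have D: "linear (\<lambda>Z. - blinfun_apply \<eta> (\<mu> X Z) + blinfun_apply \<xi> (\<mu> Y Z) + H X Y Z)" for X Y \<xi> \<eta>
    by (rule linearI) (simp_all add: bracket_lin blinfun.bilinear_simps three_form_linear[OF H]
        algebra_simps)
  have dual: "blinfun_apply (dual_map R \<xi>) Z = \<xi> (R Z)" for \<xi> Z
    unfolding dual_map_def
    by (subst Blinfun_apply) (auto intro!: linearI simp: linear_add[OF Rlin] linear_cmul[OF Rlin]
        blinfun.bilinear_simps)
  have dorf: "fst (dorfman \<mu> H (X, \<xi>) (Y, \<eta>)) = \<mu> X Y"
    "blinfun_apply (snd (dorfman \<mu> H (X, \<xi>) (Y, \<eta>))) Z = - \<eta> (\<mu> X Z) + \<xi> (\<mu> Y Z) + H X Y Z"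
    for X Y Z \<xi> \<eta>
    by (simp_all only: dorfman_def prod.case fst_conv snd_conv Blinfun_apply[OF D])
  have Efst: "fst (E p) = R (fst p)" for p by (cases p) (simp add: E)
  have Esnd: "blinfun_apply (snd (E p)) Z = - \<beta> (fst p) Z - blinfun_apply (snd p) (R Z)" for p Z
    by (cases p) (simp add: E blinfun.bilinear_simps form_map_apply[OF bl] dual)
  show thesis
  proof (rule that)
    fix X Y
    show "R (\<mu> X Y) = \<mu> (R X) Y + \<mu> X (R Y) + c *\<^sub>R \<mu> X Y"
      using arg_cong[OF c[of "(X, 0)" "(Y, 0)"], of fst]
      by (simp add: Theta_def Efst E dorf algebra_simps)
    fix Z
    have "blinfun_apply (snd (Theta E (dorfman \<mu> H) (X, 0) (Y, 0))) Z = c * H X Y Z"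
      by (simp add: c dorf blinfun.bilinear_simps)
    then show "ext_deriv2 \<mu> \<beta> X Y Z = act3 R H X Y Z + c * H X Y Z"
      using skew[of "\<mu> Y Z" X] skew[of "\<mu> X Z" Y] bracket_skew[of Z X]
      by (simp add: Theta_def Esnd E dorf blinfun.bilinear_simps form_map_apply[OF bl] dual
          ext_deriv2_def act3_def bilinear_lneg[OF bl] bilinear_rneg[OF bl])
  qed
qed

end

section \<open>The pairing of the codifferential with its image under the Ricci endomorphism\<close>

context metric_lie_algebra
begin

lemma ext_deriv2_cyclic: "ext_deriv2 \<mu> \<gamma> Y Z X = ext_deriv2 \<mu> \<gamma> X Y Z"
  by (simp add: ext_deriv2_def)

lemma ext_deriv2_act2:
  assumes \<gamma>: "bilinear \<gamma>"
    and R: "\<And>X Y. R (\<mu> X Y) = \<mu> (R X) Y + \<mu> X (R Y) + c *\<^sub>R \<mu> X Y"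
  shows "ext_deriv2 \<mu> (act2 R \<gamma>) X Y Z =
    act3 R (ext_deriv2 \<mu> \<gamma>) X Y Z + c * ext_deriv2 \<mu> \<gamma> X Y Z"
  by (simp add: ext_deriv2_def act2_def act3_def R bilinear_ladd[OF \<gamma>] bilinear_lmul[OF \<gamma>]
      algebra_simps)

text \<open>
  A symmetric endomorphism acts symmetrically on forms. By cyclic invariance of both 3-forms it
  suffices to move \<open>R\<close> from the first slot of one to the first slot of the other.
\<close>

lemma act3_symmetric:
  assumes H: "three_form H" and \<gamma>: "bilinear \<gamma>"
    and R: "\<And>X Y. g (R X) Y = g X (R Y)"
  shows "(\<Sum>x\<in>B. \<Sum>y\<in>B. \<Sum>z\<in>B. H x y z * act3 R (ext_deriv2 \<mu> \<gamma>) x y z) =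
    (\<Sum>x\<in>B. \<Sum>y\<in>B. \<Sum>z\<in>B. act3 R H x y z * ext_deriv2 \<mu> \<gamma> x y z)"
proof -
  let ?G = "ext_deriv2 \<mu> \<gamma>"
  have Hc: "H y z x = H x y z" "H z x y = H x y z" for x y z
    by (metis three_form_cyclic[OF H])+
  have Gc: "?G y z x = ?G x y z" "?G z x y = ?G x y z" for x y z
    by (metis ext_deriv2_cyclic)+
  have F: "bilinear (\<lambda>X Y. \<Sum>y\<in>B. \<Sum>z\<in>B. H Y y z * ?G X y z)"
    unfolding bilinear_def ext_deriv2_def
    by (auto intro!: linearI simp: three_form_linear[OF H] bilinear_ladd[OF \<gamma>]
        bilinear_radd[OF \<gamma>] bilinear_lmul[OF \<gamma>] bilinear_rmul[OF \<gamma>] bracket_lin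
        algebra_simps sum.distrib sum_distrib_left sum_subtractf sum_negf)
  have "(\<Sum>x\<in>B. \<Sum>y\<in>B. \<Sum>z\<in>B. H x y z * act3 R ?G x y z) =
      3 * (\<Sum>x\<in>B. \<Sum>y\<in>B. \<Sum>z\<in>B. H x y z * ?G (R x) y z)"
    unfolding sum_cyclic[symmetric]
  proof (intro sum.cong refl)
    fix x y z
    show "H x y z * act3 R ?G x y z = H x y z * ?G (R x) y z + H y z x * ?G (R y) z x
        + H z x y * ?G (R z) x y"
      using Gc[where x = x and y = "R y" and z = z] Gc[where x = x and y = y and z = "R z"]
      unfolding Hc[where x = x and y = y and z = z] by (simp add: act3_def algebra_simps)
  qed
  also have "(\<Sum>x\<in>B. \<Sum>y\<in>B. \<Sum>z\<in>B. H x y z * ?G (R x) y z) =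
      (\<Sum>x\<in>B. \<Sum>y\<in>B. \<Sum>z\<in>B. H (R x) y z * ?G x y z)"
    by (rule sum_adjoint[OF F R])
  also have "3 * \<dots> = (\<Sum>x\<in>B. \<Sum>y\<in>B. \<Sum>z\<in>B. act3 R H x y z * ?G x y z)"
    unfolding sum_cyclic[symmetric]
  proof (intro sum.cong refl)
    fix x y z
    show "H (R x) y z * ?G x y z + H (R y) z x * ?G y z x + H (R z) x y * ?G z x y =
        act3 R H x y z * ?G x y z"
      using Hc[where x = x and y = "R y" and z = z] Hc[where x = x and y = y and z = "R z"]
      unfolding Gc[where x = x and y = y and z = z] by (simp add: act3_def algebra_simps)
  qed
  finally show ?thesis .
qed

text \<open>
  With \<open>d(R\<cdot>\<beta>) = R\<cdot>d\<beta> + c d\<beta>\<close>, adjointness turns \<open>\<langle>\<beta>, R\<cdot>\<beta>\<rangle>\<close> into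
  \<open>\<langle>H, R\<cdot>d\<beta> + c d\<beta>\<rangle> = \<langle>R\<cdot>H + c H, d\<beta>\<rangle> = |d\<beta>|\<^sup>2\<close>. The multiple \<open>c\<close> occurs in both
  equations with the same sign, and so it disappears.
\<close>

lemma sum_act2_soliton:
  assumes uni: "unimodular \<mu>" and H: "three_form H"
    and R: "\<And>X Y. g (R X) Y = g X (R Y)" and Rlin: "linear R"
    and der: "\<And>X Y. R (\<mu> X Y) = \<mu> (R X) Y + \<mu> X (R Y) + c *\<^sub>R \<mu> X Y"
  defines "\<beta> \<equiv> codiff \<mu> g H"
  assumes d\<beta>: "\<And>X Y Z. ext_deriv2 \<mu> \<beta> X Y Z = act3 R H X Y Z + c * H X Y Z"
  shows "3 * (\<Sum>x\<in>B. \<Sum>y\<in>B. \<beta> x y * act2 R \<beta> x y) =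
    (\<Sum>x\<in>B. \<Sum>y\<in>B. \<Sum>z\<in>B. (ext_deriv2 \<mu> \<beta> x y z)\<^sup>2)"
proof -
  let ?G = "ext_deriv2 \<mu> \<beta>"
  have bl: "bilinear \<beta>" unfolding \<beta>_def by (rule bilinear_codiff[OF uni H])
  have skew: "\<beta> Y X = - \<beta> X Y" for X Y unfolding \<beta>_def by (rule codiff_skew[OF uni H])
  have bl2: "bilinear (act2 R \<beta>)"
    unfolding bilinear_def act2_def
    by (auto intro!: linearI simp: linear_add[OF Rlin] linear_cmul[OF Rlin] bilinear_ladd[OF bl]
        bilinear_radd[OF bl] bilinear_lmul[OF bl] bilinear_rmul[OF bl] algebra_simps)
  have skew2: "act2 R \<beta> Y X = - act2 R \<beta> X Y" for X Y
    using skew[of "R X" Y] skew[of X "R Y"] by (simp add: act2_def)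
  have "3 * (\<Sum>x\<in>B. \<Sum>y\<in>B. \<beta> x y * act2 R \<beta> x y) =
      (\<Sum>x\<in>B. \<Sum>y\<in>B. \<Sum>z\<in>B. H x y z * ext_deriv2 \<mu> (act2 R \<beta>) x y z)"
    unfolding \<beta>_def by (rule codiff_adjoint[OF uni H bl2 skew2, unfolded \<beta>_def, symmetric])
  also have "\<dots> = (\<Sum>x\<in>B. \<Sum>y\<in>B. \<Sum>z\<in>B. H x y z * act3 R ?G x y z)
      + (\<Sum>x\<in>B. \<Sum>y\<in>B. \<Sum>z\<in>B. c * H x y z * ?G x y z)"
    by (simp add: ext_deriv2_act2[OF bl der] distrib_left sum.distrib mult.left_commute mult.assoc)
  also have "\<dots> = (\<Sum>x\<in>B. \<Sum>y\<in>B. \<Sum>z\<in>B. (act3 R H x y z + c * H x y z) * ?G x y z)"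
    by (simp add: act3_symmetric[OF H bl R] distrib_right sum.distrib)
  also have "\<dots> = (\<Sum>x\<in>B. \<Sum>y\<in>B. \<Sum>z\<in>B. (?G x y z)\<^sup>2)"
    by (simp add: d\<beta> power2_eq_square)
  finally show ?thesis .
qed

lemma sum_act2_endo:
  assumes R: "\<And>X Y. g (R X) Y = g X (R Y)"
    and b: "\<And>X Y. g (b X) Y = \<beta> X Y" and skew: "\<And>X Y. \<beta> Y X = - \<beta> X Y"
  shows "(\<Sum>x\<in>B. \<Sum>y\<in>B. \<beta> x y * act2 R \<beta> x y) = 2 * (\<Sum>x\<in>B. g (R (b x)) (b x))"
proof -
  have 1: "(\<Sum>x\<in>B. \<Sum>y\<in>B. \<beta> x y * \<beta> (R x) y) = (\<Sum>y\<in>B. g (R (b y)) (b y))"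
  proof (subst sum.swap, intro sum.cong refl)
    fix y
    have "\<beta> X y = - g (b y) X" for X using skew[of X y] b by simp
    then show "(\<Sum>x\<in>B. \<beta> x y * \<beta> (R x) y) = g (R (b y)) (b y)"
      by (subst parseval) (simp add: R metric_sym mult.commute)
  qed
  have 2: "(\<Sum>x\<in>B. \<Sum>y\<in>B. \<beta> x y * \<beta> x (R y)) = (\<Sum>x\<in>B. \<Sum>y\<in>B. \<beta> x y * \<beta> (R x) y)"
  proof (subst sum.swap, intro sum.cong refl)
    fix x y
    show "\<beta> y x * \<beta> y (R x) = \<beta> x y * \<beta> (R x) y"
      using skew[of x y] skew[of "R x" y] by simp
  qed
  show ?thesis using 1 2 by (simp add: act2_def distrib_left sum.distrib)
qed

text \<open>
  With \<open>T(x, y, z) = g(\<mu>(x, y), b z)\<close> and \<open>U(x, y, z) = g(\<mu>(b x, y), z)\<close>,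
  \<open>d\<beta>\<close> is the cyclic sum of \<open>T\<close>, so its square sum is three times that of \<open>T\<close> plus six times the
  mixed sum \<open>\<Sum> T(x, y, z) T(y, z, x)\<close>. Moving \<open>b\<close> across twice by skewness turns the mixed sum
  into \<open>- \<Sum> U(x, y, z) U(z, y, x)\<close>, which is completed to a square. The sums of \<open>T\<^sup>2\<close> and \<open>U\<^sup>2\<close>
  are those of the Ricci curvature evaluated on the vectors \<open>b e\<close>.
\<close>

lemma sum_ext_deriv2_square:
  assumes \<beta>: "bilinear \<beta>" and b: "\<And>X Y. g (b X) Y = \<beta> X Y" and skew: "\<And>X Y. \<beta> Y X = - \<beta> X Y"
  shows "(\<Sum>x\<in>B. \<Sum>y\<in>B. \<Sum>z\<in>B. (ext_deriv2 \<mu> \<beta> x y z)\<^sup>2) =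
    3 * (\<Sum>x\<in>B. \<Sum>y\<in>B. \<Sum>z\<in>B. (g (\<mu> x y) (b z))\<^sup>2)
    - 6 * (\<Sum>x\<in>B. \<Sum>y\<in>B. \<Sum>z\<in>B. (g (\<mu> (b x) y) z)\<^sup>2)
    + 3 * (\<Sum>x\<in>B. \<Sum>y\<in>B. \<Sum>z\<in>B. (g (\<mu> (b x) y) z - g (\<mu> (b z) y) x)\<^sup>2)"
proof -
  define T where "T x y z = g (\<mu> x y) (b z)" for x y z
  define U where "U x y z = g (\<mu> (b x) y) z" for x y z
  have bT: "g (b X) Y = - g X (b Y)" for X Y
    using b[of X Y] b[of Y X] skew[of X Y] metric_sym[of X "b Y"] by simp
  have G: "ext_deriv2 \<mu> \<beta> x y z = T x y z + T y z x + T z x y" for x y z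
    by (simp add: ext_deriv2_def T_def bT flip: b)
  have S: "(\<Sum>x\<in>B. \<Sum>y\<in>B. \<Sum>z\<in>B. T x y z * T y z x) = - (\<Sum>x\<in>B. \<Sum>y\<in>B. \<Sum>z\<in>B. U x y z * U z y x)"
  proof -
    have "(\<Sum>z\<in>B. T x y z * T y z x) = - (\<Sum>z\<in>B. g (\<mu> x y) z * g (\<mu> y (b z)) (b x))" for x y
    proof -
      have "bilinear (\<lambda>Z W. g (\<mu> x y) Z * g (\<mu> y W) (b x))"
        unfolding bilinear_def by (auto intro!: linearI simp: metric_lin bracket_lin algebra_simps)
      from sum_adjoint[OF this, of b "\<lambda>Z. - b Z"] bT show ?thesis
        by (simp add: T_def metric_lin bracket_lin sum_negf)
    qed
    then have "(\<Sum>x\<in>B. \<Sum>y\<in>B. \<Sum>z\<in>B. T x y z * T y z x) =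
        - (\<Sum>x\<in>B. \<Sum>y\<in>B. \<Sum>z\<in>B. g (\<mu> x y) z * g (\<mu> y (b z)) (b x))"
      by (simp add: sum_negf)
    also have "(\<Sum>x\<in>B. \<Sum>y\<in>B. \<Sum>z\<in>B. g (\<mu> x y) z * g (\<mu> y (b z)) (b x)) =
        (\<Sum>x\<in>B. \<Sum>y\<in>B. \<Sum>z\<in>B. U x y z * U z y x)"
    proof -
      have "bilinear (\<lambda>X X'. \<Sum>y\<in>B. \<Sum>z\<in>B. g (\<mu> X' y) z * g (\<mu> y (b z)) X)"
        unfolding bilinear_def by (auto intro!: linearI simp: metric_lin bracket_lin algebra_simps
            sum.distrib sum_distrib_left)
      from sum_adjoint[OF this, of b "\<lambda>Z. - b Z"] bT
      have "(\<Sum>x\<in>B. \<Sum>y\<in>B. \<Sum>z\<in>B. g (\<mu> x y) z * g (\<mu> y (b z)) (b x)) =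
          (\<Sum>x\<in>B. \<Sum>y\<in>B. \<Sum>z\<in>B. g (\<mu> (- b x) y) z * g (\<mu> y (b z)) x)"
        by (simp add: metric_lin)
      also have "\<dots> = (\<Sum>x\<in>B. \<Sum>y\<in>B. \<Sum>z\<in>B. U x y z * U z y x)"
      proof (intro sum.cong refl)
        fix x y z
        show "g (\<mu> (- b x) y) z * g (\<mu> y (b z)) x = U x y z * U z y x"
          using bracket_skew[of y "b z"] by (simp add: U_def metric_lin bracket_lin)
      qed
      finally show ?thesis .
    qed
    finally show ?thesis .
  qed
  have "(\<Sum>x\<in>B. \<Sum>y\<in>B. \<Sum>z\<in>B. (ext_deriv2 \<mu> \<beta> x y z)\<^sup>2) =
      3 * (\<Sum>x\<in>B. \<Sum>y\<in>B. \<Sum>z\<in>B. (T x y z)\<^sup>2 + 2 * (T x y z * T y z x))"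
    unfolding sum_cyclic[symmetric] G
    by (intro sum.cong refl) (simp add: power2_eq_square algebra_simps)
  also have "\<dots> = 3 * (\<Sum>x\<in>B. \<Sum>y\<in>B. \<Sum>z\<in>B. (T x y z)\<^sup>2)
      - 3 * (2 * (\<Sum>x\<in>B. \<Sum>y\<in>B. \<Sum>z\<in>B. U x y z * U z y x))"
    using S by (simp add: sum.distrib flip: sum_distrib_left)
  also have "2 * (\<Sum>x\<in>B. \<Sum>y\<in>B. \<Sum>z\<in>B. U x y z * U z y x) =
      2 * (\<Sum>x\<in>B. \<Sum>y\<in>B. \<Sum>z\<in>B. (U x y z)\<^sup>2)
      - (\<Sum>x\<in>B. \<Sum>y\<in>B. \<Sum>z\<in>B. (U x y z - U z y x)\<^sup>2)"
  proof -
    have r: "(\<Sum>x\<in>B. \<Sum>y\<in>B. \<Sum>z\<in>B. (U z y x)\<^sup>2) = (\<Sum>x\<in>B. \<Sum>y\<in>B. \<Sum>z\<in>B. (U x y z)\<^sup>2)"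
    proof -
      have "(\<Sum>x\<in>B. \<Sum>y\<in>B. \<Sum>z\<in>B. (U z y x)\<^sup>2) = (\<Sum>x\<in>B. \<Sum>z\<in>B. \<Sum>y\<in>B. (U z y x)\<^sup>2)"
        by (intro sum.cong refl sum.swap)
      also have "\<dots> = (\<Sum>x\<in>B. \<Sum>y\<in>B. \<Sum>z\<in>B. (U x y z)\<^sup>2)"
        by (rule sum_rotate)
      finally show ?thesis .
    qed
    show ?thesis
      unfolding power2_diff using r
      by (simp add: sum.distrib sum_subtractf mult.assoc flip: sum_distrib_left)
  qed
  finally show ?thesis by (simp add: T_def U_def)
qed

text \<open>
  Eliminating \<open>3 T2 - 6 U2\<close> from the two expressions for the pairing gives
  \<open>G2 + 3 V2 + 6 K + 3 H2 = 0\<close> in the notation of the proof.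
\<close>

lemma harmonic_torsion:
  assumes uni: "unimodular \<mu>" and killing: "\<And>X. killing_form \<mu> X X \<ge> 0"
    and H: "three_form H" and sol: "algebraic_gen_ricci_soliton \<mu> g H"
  shows "codiff \<mu> g H X Y = 0"
proof -
  define R where "R = ricci_H_endo \<mu> g H"
  define \<beta> where "\<beta> = codiff \<mu> g H"
  define b where "b X = sharp g (form_map \<beta> X)" for X
  let ?G = "ext_deriv2 \<mu> \<beta>"
  obtain c where der: "\<And>X Y. R (\<mu> X Y) = \<mu> (R X) Y + \<mu> X (R Y) + c *\<^sub>R \<mu> X Y"
    and d\<beta>: "\<And>X Y Z. ?G X Y Z = act3 R H X Y Z + c * H X Y Z"
    unfolding R_def \<beta>_def by (rule soliton_equations[OF uni H sol]) blast
  have bl: "bilinear \<beta>" unfolding \<beta>_def by (rule bilinear_codiff[OF uni H])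
  have skew: "\<beta> Y X = - \<beta> X Y" for X Y unfolding \<beta>_def by (rule codiff_skew[OF uni H])
  have b: "g (b X) Y = \<beta> X Y" for X Y
    by (simp add: b_def metric_sharp[OF metric] form_map_apply[OF bl])
  have R: "g (R X) Y = g X (R Y)" for X Y unfolding R_def by (rule ricci_H_endo_sym[OF uni H])
  have Rlin: "linear R"
    by (auto intro!: linearI metric_eqI[OF metric] simp: R metric_lin)
  define G2 where "G2 = (\<Sum>x\<in>B. \<Sum>y\<in>B. \<Sum>z\<in>B. (?G x y z)\<^sup>2)"
  define T2 where "T2 = (\<Sum>x\<in>B. \<Sum>y\<in>B. \<Sum>z\<in>B. (g (\<mu> x y) (b z))\<^sup>2)"
  define U2 where "U2 = (\<Sum>x\<in>B. \<Sum>y\<in>B. \<Sum>z\<in>B. (g (\<mu> (b x) y) z)\<^sup>2)"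
  define V2 where "V2 = (\<Sum>x\<in>B. \<Sum>y\<in>B. \<Sum>z\<in>B. (g (\<mu> (b x) y) z - g (\<mu> (b z) y) x)\<^sup>2)"
  define K where "K = (\<Sum>x\<in>B. killing_form \<mu> (b x) (b x))"
  define H2 where "H2 = (\<Sum>x\<in>B. \<Sum>y\<in>B. \<Sum>z\<in>B. (H (b x) y z)\<^sup>2)"
  have "6 * (\<Sum>x\<in>B. g (R (b x)) (b x)) = G2"
    using sum_act2_soliton[OF uni H R Rlin der d\<beta>[unfolded \<beta>_def]] sum_act2_endo[OF R b skew]
    by (simp add: G2_def \<beta>_def)
  moreover have "(\<Sum>x\<in>B. g (R (b x)) (b x)) = - U2 / 2 + T2 / 4 - K / 2 - H2 / 4"
  proof -
    have "(\<Sum>z\<in>B. \<Sum>x\<in>B. \<Sum>y\<in>B. (g (\<mu> x y) (b z))\<^sup>2) = T2"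
      unfolding T2_def by (rule sum_rotate[of "\<lambda>x y z. (g (\<mu> x y) (b z))\<^sup>2"])
    then show ?thesis
      by (simp add: R_def ricci_H_endo_metric[OF uni H] ricci_frame[OF uni] H_square_frame[OF H]
          U2_def K_def H2_def sum.distrib sum_subtractf sum_negf power2_eq_square
          flip: sum_divide_distrib)
  qed
  moreover have "G2 = 3 * T2 - 6 * U2 + 3 * V2"
    unfolding G2_def T2_def U2_def V2_def by (rule sum_ext_deriv2_square[OF bl b skew])
  moreover have "G2 \<ge> 0" "V2 \<ge> 0" "K \<ge> 0" "H2 \<ge> 0"
    unfolding G2_def V2_def K_def H2_def by (auto intro!: sum_nonneg killing)
  ultimately have "G2 = 0" by simp
  then have G: "?G x y z = 0" if "x \<in> B" "y \<in> B" "z \<in> B" for x y z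
    using that finite_frame by (simp add: G2_def sum_nonneg_eq_0_iff sum_nonneg)
  then have "(\<Sum>x\<in>B. \<Sum>y\<in>B. \<Sum>z\<in>B. H x y z * ?G x y z) = 0"
    by simp
  then have "(\<Sum>x\<in>B. \<Sum>y\<in>B. (\<beta> x y)\<^sup>2) = 0"
    using codiff_adjoint[OF uni H bl skew] by (simp add: \<beta>_def power2_eq_square)
  then have "\<beta> x y = 0" if "x \<in> B" "y \<in> B" for x y
    using that finite_frame by (simp add: sum_nonneg_eq_0_iff sum_nonneg)
  then show ?thesis
    using zero_if_zero_on_frame[OF bl] unfolding \<beta>_def by blast
qed

end

theorem corollary2:
  fixes \<mu> :: "'a::euclidean_space \<Rightarrow> 'a \<Rightarrow> 'a"
    and g :: "'a \<Rightarrow> 'a \<Rightarrow> real"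
    and H :: "'a \<Rightarrow> 'a \<Rightarrow> 'a \<Rightarrow> real"
  assumes "lie_bracket \<mu>"
    and "unimodular \<mu>"
    and "\<And>X. killing_form \<mu> X X \<ge> 0"
    and "riemannian_metric g"
    and "three_form H"
    and "closed3 \<mu> H"
    and "algebraic_gen_ricci_soliton \<mu> g H"
  shows "\<forall>X Y. codiff \<mu> g H X Y = 0"
proof -
  obtain B where "finite B" "span B = span Basis"
    and "\<forall>u\<in>B. \<forall>v\<in>B. g u v = (if u = v then 1 else 0)"
    using exists_orthonormal_spanning[OF \<open>riemannian_metric g\<close> finite_Basis] by blast
  then interpret metric_lie_algebra g B \<mu>
    using assms(1,4) by unfold_locales auto
  show ?thesis using harmonic_torsion assms(2,3,5,7) by blast
qed

end
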